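(* Let $G$ be a Carnot group with step $s$, homogeneous dimension $Q$, $n=\dim V_1$, let $p\in[1,\infty]$ and let $f\in L^1_{\mathrm{loc}}(G)$. (i) If $1\le p<\frac{Q}{Q-1}$, $\int_G |f|(1+|x|_R)\,dx<\infty$ and $|x|_Rf,\ |x|_R^2 f\in L^p(G)$, then there exist functions $F_{ij}\in L^p(G)$ ($1\le i,j\le N$) and $F_i\in L^p(G)$ ($n+1\le i\le N$) such that, in the sense of distributions, $$f=\Big(\int_G f\,dx\Big)\delta_0-\sum_{i=1}^n\Big(\int_G f(x)\,x_i\,dx\Big)X^i\delta_0+\sum_{i,j=1}^N X^iX^j(F_{ij})+\sum_{i=n+1}^N X^i(F_i).$$ (ii) If $Q>2s$, $p>\frac{Q}{Q-2s}$ and $|x|_Rf,\ |x|_R^2f\in L^p(G)$, then there exist $F_{ij}\in L^p(G)$ ($1\le i,j\le N$) and $F_i\in L^p(G)$ ($n+1\le i\le N$) such that, in the sense of distributions, $$f=\sum_{i,j=1}^N X^iX^j(F_{ij})+\sum_{i=n+1}^N X^i(F_i).$$ In both cases these functions can be chosen with $\|F_{ij}\|_{L^p}\le C\,\||x|_R^2 f\|_{L^p}$ and $\|F_i\|_{L^p}\le C\,\||x|_R f\|_{L^p}$, where $C$ depends only on $p$ and $G$.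
   Context: A Carnot group $G$ is a connected, simply connected nilpotent Lie group whose Lie algebra $\mathfrak g$ carries a stratification $\mathfrak g=V_1\oplus\cdots\oplus V_s$ with $[V_1,V_i]=V_{i+1}$ for $1\le i<s$, $[V_1,V_s]=0$, $V_s\neq0$ ($s$ is the step), together with an inner product on $V_1$. Fix a basis $X^1,\dots,X^N$ of $\mathfrak g$ adapted to the stratification and ordered by increasing layer (each $X^i$ lies in some layer $V_{w^i}$; $w^i$ is its weight), with $X^1,\dots,X^n$ an orthonormal basis of $V_1$, so $w^i=1$ iff $i\le n$. Identify $G$ with $\mathbb R^N$ through exponential coordinates $x=(x_1,\dots,x_N)\leftrightarrow\exp(\sum_i x_iX^i)$; each $X^i$ is regarded as a left-invariant vector field on $G$. The Haar measure $dx$ is Lebesgue measure in these coordinates and $L^p(G)$ is taken with respect to it. Dilations: $\Gamma_r(x)=(r^{w^1}x_1,\dots,r^{w^N}x_N)$; homogeneous dimension $Q=\sum_i w^i$. Here $|x|_R=(\sum_{i=1}^N x_i^2)^{1/2}$. $\delta_0$ is the Dirac mass at the identity $0$. Distributional derivatives: the $X^i$ are skew-adjoint with respect to $dx$, and for a distribution $T$ one sets $\langle X^iT,\phi\rangle=-\langle T,X^i\phi\rangle$ for $\phi\in C_c^\infty(G)$; in particular $\langle X^i\delta_0,\phi\rangle=-(X^i\phi)(0)$. *)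

theory Defs
  imports "HOL-Analysis.Analysis" "HOL-Probability.Essential_Supremum"
begin

fun iter_dd :: "'a::real_normed_vector list \<Rightarrow> ('a \<Rightarrow> real) \<Rightarrow> 'a \<Rightarrow> real" where
  "iter_dd [] f = f"
| "iter_dd (v # vs) f = (\<lambda>x. deriv (\<lambda>t. iter_dd vs f (x + t *\<^sub>R v)) 0)"

definition smooth :: "('a::euclidean_space \<Rightarrow> real) \<Rightarrow> bool" where
  "smooth f \<longleftrightarrow>
     (\<forall>vs v x. (\<lambda>t. iter_dd vs f (x + t *\<^sub>R v)) differentiable (at 0)) \<and>
     (\<forall>vs. continuous_on UNIV (iter_dd vs f))"

definition test_fn :: "('a::euclidean_space \<Rightarrow> real) \<Rightarrow> bool" where
  "test_fn \<phi> \<longleftrightarrow> smooth \<phi> \<and> (\<exists>R. \<forall>x. R < norm x \<longrightarrow> \<phi> x = 0)"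

text \<open>Left-invariant vector field of the group law mul, associated with v in the Lie algebra
  (exponential coordinates: exp(t v) = t v), acting on functions.\<close>
definition lvf :: "('a::real_normed_vector \<Rightarrow> 'a \<Rightarrow> 'a) \<Rightarrow> 'a \<Rightarrow> ('a \<Rightarrow> real) \<Rightarrow> 'a \<Rightarrow> real" where
  "lvf mul v \<phi> x = deriv (\<lambda>t. \<phi> (mul x (t *\<^sub>R v))) 0"

definition layer :: "('a::euclidean_space \<Rightarrow> nat) \<Rightarrow> nat \<Rightarrow> 'a set" where
  "layer w k = span {b \<in> Basis. w b = k}"

text \<open>(mul, br, w, s): a Carnot group of step s in exponential coordinates w.r.t. the basis
  Basis of 'a, adapted to the stratification with weights w, with Lie bracket br
  (br is the bracket of left-invariant vector fields).\<close>
definition carnot_group ::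
  "('a::euclidean_space \<Rightarrow> 'a \<Rightarrow> 'a) \<Rightarrow> ('a \<Rightarrow> 'a \<Rightarrow> 'a) \<Rightarrow> ('a \<Rightarrow> nat) \<Rightarrow> nat \<Rightarrow> bool" where
  "carnot_group mul br w s \<longleftrightarrow>
     (\<forall>x y z. mul (mul x y) z = mul x (mul y z)) \<and>
     (\<forall>v a c. mul (a *\<^sub>R v) (c *\<^sub>R v) = (a + c) *\<^sub>R v) \<and>
     (\<forall>b\<in>Basis. smooth (\<lambda>z::'a \<times> 'a. mul (fst z) (snd z) \<bullet> b)) \<and>
     (\<forall>u v \<phi> x. smooth \<phi> \<longrightarrow>
        lvf mul u (lvf mul v \<phi>) x - lvf mul v (lvf mul u \<phi>) x = lvf mul (br u v) \<phi> x) \<and>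
     1 \<le> s \<and> (\<forall>b\<in>Basis. 1 \<le> w b \<and> w b \<le> s) \<and>
     (\<forall>k\<in>{1..<s}. span {br u v | u v. u \<in> layer w 1 \<and> v \<in> layer w k} = layer w (Suc k)) \<and>
     (\<forall>u\<in>layer w 1. \<forall>v\<in>layer w s. br u v = 0) \<and>
     layer w s \<noteq> {0}"

definition hom_dim :: "('a::euclidean_space \<Rightarrow> nat) \<Rightarrow> nat" where
  "hom_dim w = (\<Sum>b\<in>Basis. w b)"

definition memLp :: "ereal \<Rightarrow> ('a::euclidean_space \<Rightarrow> real) \<Rightarrow> bool" where
  "memLp p g \<longleftrightarrow> g \<in> borel_measurable lebesgue \<and>
     (if p = \<infinity> then esssup lebesgue (\<lambda>x. ereal \<bar>g x\<bar>) < \<infinity>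
      else integrable lebesgue (\<lambda>x. \<bar>g x\<bar> powr real_of_ereal p))"

definition Lp_norm :: "ereal \<Rightarrow> ('a::euclidean_space \<Rightarrow> real) \<Rightarrow> real" where
  "Lp_norm p g =
     (if p = \<infinity> then real_of_ereal (esssup lebesgue (\<lambda>x. ereal \<bar>g x\<bar>))
      else (integral\<^sup>L lebesgue (\<lambda>x. \<bar>g x\<bar> powr real_of_ereal p)) powr (1 / real_of_ereal p))"

definition loc_integrable :: "('a::euclidean_space \<Rightarrow> real) \<Rightarrow> bool" where
  "loc_integrable f \<longleftrightarrow> (\<forall>K. compact K \<longrightarrow> set_integrable lebesgue K f)"

text \<open>The distributional identity
  f = c0 delta_0 - sum_{w b = 1} c_b X^b delta_0 + sum_{b,c} X^b X^c F_bc + sum_{w b > 1} X^b F1_b,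
  tested against phi, using <X T, phi> = - <T, X phi>.\<close>
definition distr_identity ::
  "('a::euclidean_space \<Rightarrow> 'a \<Rightarrow> 'a) \<Rightarrow> ('a \<Rightarrow> nat) \<Rightarrow> ('a \<Rightarrow> real) \<Rightarrow> real \<Rightarrow> ('a \<Rightarrow> real)
     \<Rightarrow> ('a \<Rightarrow> 'a \<Rightarrow> 'a \<Rightarrow> real) \<Rightarrow> ('a \<Rightarrow> 'a \<Rightarrow> real) \<Rightarrow> bool" where
  "distr_identity mul w f c0 c1 F F1 \<longleftrightarrow>
     (\<forall>\<phi>. test_fn \<phi> \<longrightarrow>
        (\<integral>x. f x * \<phi> x \<partial>lebesgue) =
          c0 * \<phi> 0
        + (\<Sum>b\<in>{b\<in>Basis. w b = 1}. c1 b * lvf mul b \<phi> 0)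
        + (\<Sum>b\<in>Basis. \<Sum>c\<in>Basis. \<integral>x. F b c x * lvf mul c (lvf mul b \<phi>) x \<partial>lebesgue)
        - (\<Sum>b\<in>{b\<in>Basis. w b \<noteq> 1}. \<integral>x. F1 b x * lvf mul b \<phi> x \<partial>lebesgue))"

end

theory Submission
  imports Defs
begin

text \<open>The idea is to use isotropic Euclidean dilations instead of the anisotropic ones: in exponential
  coordinates \<open>t \<mapsto> t x\<close> is a one-parameter subgroup, so
  \<open>d/dt \<phi>(t x) = \<Sum>\<^sub>b x\<^sub>b (X\<^sup>b \<phi>)(t x)\<close>. Taylor's formula on \<open>[0, 1]\<close> therefore writes \<open>\<phi>(x)\<close> as
  \<open>\<phi>(0) + \<Sum> x\<^sub>b (X\<^sup>b \<phi>)(0)\<close> over \<open>w b = 1\<close>, plus the terms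
  \<open>x\<^sub>b x\<^sub>c \<integral> (1 - t) (X\<^sup>c X\<^sup>b \<phi>)(t x) dt\<close> for \<open>w b = 1\<close> and \<open>x\<^sub>b \<integral> (X\<^sup>b \<phi>)(t x) dt\<close> for \<open>w b > 1\<close>;
  in the supercritical range one integrates twice from infinity instead:
  \<open>\<phi>(x) = \<Sum> x\<^sub>b x\<^sub>c \<integral> (t - 1) (X\<^sup>c X\<^sup>b \<phi>)(t x) dt\<close> over \<open>t > 1\<close>. Multiplying by \<open>f\<close> and substituting
  \<open>y = t x\<close> gives \<open>F\<close> as averages of dilates of \<open>x\<^sub>b x\<^sub>c f\<close>. With \<open>N\<close> the topological dimension, a
  dilate scales the \<open>L\<^sup>p\<close> norm by \<open>t\<close> to the power \<open>N/p - N\<close>, so the averages are bounded if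
  \<open>p < N/(N-1)\<close>, respectively \<open>p > N/(N-2)\<close>, which follows from \<open>N \<le> Q \<le> s N\<close>.\<close>

section \<open>Averages along dilations\<close>

text \<open>Convexity on the open half-line gives the tangent bound at interior points. The boundary
  cases are separate: for \<open>l = 0\<close> the convention \<open>0 powr y = 0\<close> makes the
  left side vanish, and for \<open>x = 0\<close> the claim reduces to
  \<open>l powr q \<le> q * l powr q\<close>.\<close>

lemma powr_above_tangent:
  fixes x l q :: real
  assumes "1 \<le> q" "0 \<le> x" "0 \<le> l"
  shows "l powr q + q * l powr (q - 1) * (x - l) \<le> x powr q"
proof (cases "l = 0 \<or> x = 0")
  case True
  then show ?thesis
  proof
    assume "l = 0" then show ?thesis using assms by auto
  next
    assume x: "x = 0"
    have "l * l powr (q - 1) = l powr q"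
      using assms by (cases "l = 0") (auto simp: powr_mult_base)
    moreover have "l powr q \<le> q * l powr q"
      using assms by (simp add: mult_le_cancel_right1)
    ultimately show ?thesis using x assms by (simp add: algebra_simps)
  qed
next
  case False
  with assms have pos: "0 < l" "0 < x" by auto
  have "((\<lambda>x. x powr q) has_real_derivative q * l powr (q - 1)) (at l within {0<..})"
    using pos by (auto intro!: derivative_eq_intros)
  moreover have "convex_on {0<..} (\<lambda>x. x powr q)"
    using powr_convex[of q] assms by auto
  ultimately have "x powr q - l powr q \<ge> q * l powr (q - 1) * (x - l)"
    by (intro convex_on_imp_above_tangent[where A = "{0<..}"])
       (use pos in \<open>auto simp: interior_open connected_Ioi\<close>)
  then show ?thesis by simp
qed

text \<open>A crude substitute for Hoelder's inequality: it dominates a first power by a bounded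
  part plus a \<open>q\<close>-th power, which is enough wherever only integrability is at
  stake.\<close>

lemma le_one_plus_powr:
  fixes z q :: real
  assumes "0 \<le> z" "1 \<le> q"
  shows "z \<le> 1 + z powr q"
proof (cases "z \<le> 1")
  case False
  then have "z powr 1 \<le> z powr q" using assms by (intro powr_mono) auto
  then show ?thesis using False by simp
qed (simp add: add_increasing2)

text \<open>Jensen's inequality for the measure \<open>k dM\<close>, from the tangent at the normalised mean.\<close>
lemma powr_integral_le:
  fixes k G :: "'b \<Rightarrow> real"
  assumes [measurable]: "k \<in> borel_measurable M" "G \<in> borel_measurable M"
    and nn: "\<And>t. 0 \<le> k t" "\<And>t. 0 \<le> G t"
    and C: "0 < C" "(\<integral>\<^sup>+t. ennreal (k t) \<partial>M) \<le> ennreal C" and q: "1 \<le> q"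
  shows "ennreal ((\<integral>t. k t * G t \<partial>M) powr q)
    \<le> ennreal (C powr (q - 1)) * (\<integral>\<^sup>+t. ennreal (k t * G t powr q) \<partial>M)"
proof (cases "(\<integral>\<^sup>+t. ennreal (k t * G t powr q) \<partial>M) < \<infinity>")
  case False
  then have "(\<integral>\<^sup>+t. ennreal (k t * G t powr q) \<partial>M) = \<infinity>" by (simp add: less_top[symmetric])
  then show ?thesis using C by (simp add: ennreal_mult_top)
next
  case True
  have ik: "integrable M k"
    using C(2) nn by (auto intro!: integrableI_nonneg simp: le_less_trans[OF _ ennreal_less_top])
  have iq: "integrable M (\<lambda>t. k t * G t powr q)"
    using True nn by (auto intro!: integrableI_nonneg)
  have ik1: "integrable M (\<lambda>t. k t * G t)"
  proof (rule Bochner_Integration.integrable_bound[of _ "\<lambda>t. k t + k t * G t powr q"])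
    show "AE t in M. norm (k t * G t) \<le> norm (k t + k t * G t powr q)"
    proof (rule AE_I2)
      fix t
      have "G t \<le> 1 + G t powr q" using nn q by (intro le_one_plus_powr)
      then have "k t * G t \<le> k t * (1 + G t powr q)" using nn by (intro mult_left_mono) auto
      then show "norm (k t * G t) \<le> norm (k t + k t * G t powr q)"
        using nn[of t] by (simp add: algebra_simps)
    qed
  qed (use ik iq in auto)
  define I m l where "I = (\<integral>t. k t * G t \<partial>M)" and "m = integral\<^sup>L M k" and "l = I / C"
  have I0: "0 \<le> I" unfolding I_def using nn by (intro integral_nonneg_AE) auto
  have l0: "0 \<le> l" unfolding l_def using I0 C by auto
  have mC: "m \<le> C"
  proof -
    have "ennreal m = (\<integral>\<^sup>+t. ennreal (k t) \<partial>M)"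
      unfolding m_def using ik nn by (subst nn_integral_eq_integral) auto
    then show ?thesis using C by (metis ennreal_le_iff less_eq_real_def)
  qed
  have "(\<integral>t. l powr q * k t + q * l powr (q - 1) * (k t * G t - l * k t) \<partial>M)
      \<le> (\<integral>t. k t * G t powr q \<partial>M)"
  proof (rule integral_mono)
    fix t
    have "k t * (l powr q + q * l powr (q - 1) * (G t - l)) \<le> k t * G t powr q"
      using powr_above_tangent[OF q nn(2) l0] nn by (intro mult_left_mono) auto
    then show "l powr q * k t + q * l powr (q - 1) * (k t * G t - l * k t) \<le> k t * G t powr q"
      by (simp add: algebra_simps)
  qed (use ik ik1 iq in auto)
  also have "(\<integral>t. l powr q * k t + q * l powr (q - 1) * (k t * G t - l * k t) \<partial>M)
      = l powr q * m + q * l powr (q - 1) * (I - l * m)"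
    using ik ik1 unfolding I_def m_def by simp
  also have "\<dots> = l powr q * m + q * l powr q * (C - m)"
  proof -
    have "I - l * m = l * (C - m)" unfolding l_def using C by (simp add: field_simps)
    moreover have "l powr (q - 1) * l = l powr q"
      using l0 q by (cases "l = 0") (auto simp: powr_mult_base mult.commute)
    ultimately show ?thesis by (metis mult.assoc)
  qed
  finally have *: "l powr q * m + q * l powr q * (C - m) \<le> (\<integral>t. k t * G t powr q \<partial>M)" .
  \<comment> \<open>The tangent was taken at \<open>I / C\<close>, although the mass
    \<open>m\<close> of \<open>k\<close> may be smaller than \<open>C\<close>. The surplus term
    carries the factor \<open>q\<close>, and since \<open>q\<close> is at least 1 it makes up for
    the missing mass \<open>C - m\<close>.\<close>
  have "1 * (l powr q * (C - m)) \<le> q * (l powr q * (C - m))"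
    using q mC by (intro mult_right_mono) auto
  with * have "l powr q * C \<le> (\<integral>t. k t * G t powr q \<partial>M)"
    by (simp add: algebra_simps)
  then have "C powr (q - 1) * (l powr q * C) \<le> C powr (q - 1) * (\<integral>t. k t * G t powr q \<partial>M)"
    by (intro mult_left_mono) auto
  moreover have "C powr (q - 1) * (l powr q * C) = I powr q"
  proof -
    have "C powr (q - 1) * C = C powr q" using C by (simp add: powr_mult_base mult.commute)
    then have "C powr (q - 1) * (l powr q * C) = C powr q * l powr q" by (simp add: algebra_simps)
    also have "\<dots> = (C * l) powr q" using C l0 by (simp add: powr_mult)
    also have "C * l = I" using C by (simp add: l_def)
    finally show ?thesis .
  qed
  ultimately have "ennreal (I powr q) \<le> ennreal (C powr (q - 1) * (\<integral>t. k t * G t powr q \<partial>M))"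
    by (simp add: ennreal_leI)
  also have "\<dots> = ennreal (C powr (q - 1)) * (\<integral>\<^sup>+t. ennreal (k t * G t powr q) \<partial>M)"
    using iq nn by (subst nn_integral_eq_integral) (auto simp: ennreal_mult)
  finally show ?thesis unfolding I_def .
qed

section \<open>Change of variables under Euclidean dilations\<close>

lemma nn_integral_lborel_scaleR:
  fixes f :: "'a::euclidean_space \<Rightarrow> ennreal"
  assumes [measurable]: "f \<in> borel_measurable borel" and t: "0 < t"
  shows "(\<integral>\<^sup>+y. f y \<partial>lborel) = ennreal (t ^ DIM('a)) * (\<integral>\<^sup>+x. f (t *\<^sub>R x) \<partial>lborel)"
proof -
  have "(\<integral>\<^sup>+y. f y \<partial>lborel)
      = (\<integral>\<^sup>+y. f y \<partial>density (distr lborel borel (\<lambda>x::'a. 0 + t *\<^sub>R x)) (\<lambda>_. \<bar>t\<bar>^DIM('a)))"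
    using t by (subst lborel_affine[of t 0]) auto
  also have "\<dots> = (\<integral>\<^sup>+x. ennreal (t ^ DIM('a)) * f (t *\<^sub>R x) \<partial>lborel)"
    using t by (simp add: nn_integral_density nn_integral_distr)
  finally show ?thesis by (simp add: nn_integral_cmult)
qed

text \<open>With \<open>a = DIM / q\<close> the Jacobian \<open>t ^ DIM\<close> cancels the factor
  \<open>t powr (- a * q)\<close>, so the normalised dilation is an isometry of
  \<open>L^q\<close>.\<close>

lemma nn_integral_dilation_powr:
  fixes g :: "'a::euclidean_space \<Rightarrow> real"
  assumes [measurable]: "g \<in> borel_measurable borel" and t: "0 < t" and aq: "a * q = real DIM('a)"
  shows "(\<integral>\<^sup>+y. ennreal ((t powr (- a) * \<bar>g ((1 / t) *\<^sub>R y)\<bar>) powr q) \<partial>lborel)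
    = (\<integral>\<^sup>+x. ennreal (\<bar>g x\<bar> powr q) \<partial>lborel)"
proof -
  let ?N = "DIM('a)"
  have tN: "(t powr (- a)) powr q * t ^ ?N = 1"
    using t aq powr_add[of t "- real ?N" "real ?N"] by (simp add: powr_powr powr_realpow)
  have "(\<integral>\<^sup>+y. ennreal ((t powr (- a) * \<bar>g ((1 / t) *\<^sub>R y)\<bar>) powr q) \<partial>lborel)
      = ennreal (t ^ ?N) * (\<integral>\<^sup>+x. ennreal ((t powr (- a) * \<bar>g ((1 / t) *\<^sub>R (t *\<^sub>R x))\<bar>) powr q) \<partial>lborel)"
    by (rule nn_integral_lborel_scaleR) (use t in auto)
  also have "\<dots> = (\<integral>\<^sup>+x. ennreal (t ^ ?N) * ennreal ((t powr (- a) * \<bar>g x\<bar>) powr q) \<partial>lborel)"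
    using t by (simp add: nn_integral_cmult)
  also have "\<dots> = (\<integral>\<^sup>+x. ennreal (\<bar>g x\<bar> powr q) \<partial>lborel)"
  proof (rule nn_integral_cong)
    fix x
    have "t ^ ?N * ((t powr (- a) * \<bar>g x\<bar>) powr q) = \<bar>g x\<bar> powr q * ((t powr (- a)) powr q * t ^ ?N)"
      by (simp add: powr_mult)
    also have "\<dots> = \<bar>g x\<bar> powr q" by (simp only: tN mult_1_right)
    finally show "ennreal (t ^ ?N) * ennreal ((t powr (- a) * \<bar>g x\<bar>) powr q) = ennreal (\<bar>g x\<bar> powr q)"
      using t by (simp add: ennreal_mult[symmetric])
  qed
  finally show ?thesis .
qed

lemma integral_lborel_scaleR:
  fixes f :: "'a::euclidean_space \<Rightarrow> real"
  assumes [measurable]: "f \<in> borel_measurable borel" and t: "0 < t"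
  shows "(\<integral>y. f y \<partial>lborel) = t ^ DIM('a) * (\<integral>x. f (t *\<^sub>R x) \<partial>lborel)"
proof -
  have "(\<integral>y. f y \<partial>lborel)
      = (\<integral>y. f y \<partial>density (distr lborel borel (\<lambda>x::'a. 0 + t *\<^sub>R x)) (\<lambda>_. ennreal (\<bar>t\<bar>^DIM('a))))"
    using t by (subst lborel_affine[of t 0]) auto
  also have "\<dots> = (\<integral>x. t ^ DIM('a) * f (t *\<^sub>R x) \<partial>lborel)"
    using t by (subst integral_density) (auto simp: integral_distr)
  finally show ?thesis by simp
qed

section \<open>Averages of dilates and the condition on their weights\<close>

text \<open>Each \<open>g (y / t) / t ^ DIM\<close> is the density of the image of
  \<open>g dx\<close> under the map sending \<open>x\<close> to \<open>t x\<close>. The average is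
  therefore the transpose of integrating a test function along rays with weight
  \<open>u\<close>.\<close>

definition dil_avg :: "(real \<Rightarrow> real) \<Rightarrow> ('a::euclidean_space \<Rightarrow> real) \<Rightarrow> 'a \<Rightarrow> real" where
  "dil_avg u g y = (\<integral>t. u t / t ^ DIM('a) * g ((1 / t) *\<^sub>R y) \<partial>lborel)"

text \<open>Dilation by \<open>t\<close> scales the \<open>L\<^sup>p\<close> norm by \<open>t powr a\<close>, \<open>a = DIM / p\<close>
  (for \<open>p = \<infinity>\<close>, the convention \<open>x / 0 = 0\<close> yields the right exponent \<open>0\<close>).\<close>
definition dil_exp :: "'a::euclidean_space itself \<Rightarrow> ereal \<Rightarrow> real" where
  "dil_exp _ p = real DIM('a) / real_of_ereal p"

text \<open>The factor \<open>t powr (dil_exp - DIM)\<close> is the \<open>L^p\<close> norm of the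
  operator sending \<open>g\<close> to \<open>g (y / t) / t ^ DIM\<close>, so \<open>C\<close> is
  the bound on \<open>dil_avg u\<close> that Minkowski's integral inequality predicts. Vanishing of
  \<open>u\<close> for nonpositive \<open>t\<close> lets all integrals run over the whole
  line.\<close>

definition kernel :: "'a::euclidean_space itself \<Rightarrow> ereal \<Rightarrow> (real \<Rightarrow> real) \<Rightarrow> real \<Rightarrow> bool" where
  "kernel T p u C \<longleftrightarrow> u \<in> borel_measurable borel \<and> (\<forall>t. 0 \<le> u t) \<and> (\<forall>t\<le>0. u t = 0) \<and> 0 < C \<and>
     (\<integral>\<^sup>+t. ennreal (u t * t powr (dil_exp T p - real DIM('a))) \<partial>lborel) \<le> ennreal C"

text \<open>A strong form of ``\<open>g\<close> has \<open>L\<^sup>p\<close> norm at most \<open>A\<close>'': \<open>g\<close> is Borel, and for \<open>p = \<infinity>\<close> the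
  bound holds everywhere rather than almost everywhere.\<close>
definition Lp_bdd :: "ereal \<Rightarrow> ('a::euclidean_space \<Rightarrow> real) \<Rightarrow> real \<Rightarrow> bool" where
  "Lp_bdd p g A \<longleftrightarrow> g \<in> borel_measurable borel \<and> 0 \<le> A \<and>
     (if p = \<infinity> then \<forall>x. \<bar>g x\<bar> \<le> A
      else (\<integral>\<^sup>+x. ennreal (\<bar>g x\<bar> powr real_of_ereal p) \<partial>lborel) \<le> ennreal (A powr real_of_ereal p))"

section \<open>Passing between \<open>Lp_bdd\<close> and \<open>memLp\<close>\<close>

lemma Lp_bdd_mono:
  assumes "Lp_bdd p g A" "1 \<le> p" "g' \<in> borel_measurable borel" "\<And>x. \<bar>g' x\<bar> \<le> \<bar>g x\<bar>" "A \<le> A'"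
  shows "Lp_bdd p g' A'"
proof (cases "p = \<infinity>")
  case True
  then show ?thesis using assms unfolding Lp_bdd_def by simp (meson order_trans)
next
  case False
  then have q: "1 \<le> real_of_ereal p" using assms(2) by (cases p) (auto simp: one_ereal_def)
  have "(\<integral>\<^sup>+x. ennreal (\<bar>g' x\<bar> powr real_of_ereal p) \<partial>lborel)
      \<le> (\<integral>\<^sup>+x. ennreal (\<bar>g x\<bar> powr real_of_ereal p) \<partial>lborel)"
    using assms(4) q by (intro nn_integral_mono ennreal_leI powr_mono2) auto
  also have "\<dots> \<le> ennreal (A powr real_of_ereal p)"
    using assms(1) False by (simp add: Lp_bdd_def)
  also have "\<dots> \<le> ennreal (A' powr real_of_ereal p)"
    using assms(1,5) q by (intro ennreal_leI powr_mono2) (auto simp: Lp_bdd_def)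
  finally show ?thesis using assms False by (auto simp: Lp_bdd_def)
qed

lemma esssup_abs_nonneg: "0 \<le> esssup (lebesgue :: 'a::euclidean_space measure) (\<lambda>x. ereal \<bar>g x\<bar>)"
proof -
  have "(0::ereal) = esssup (lebesgue :: 'a measure) (\<lambda>_. 0)"
    by (subst esssup_const) auto
  also have "\<dots> \<le> esssup lebesgue (\<lambda>x. ereal \<bar>g x\<bar>)"
    by (intro esssup_mono) auto
  finally show ?thesis .
qed

lemma Lp_norm_nonneg: "0 \<le> Lp_norm p (g :: 'a::euclidean_space \<Rightarrow> real)"
  using esssup_abs_nonneg[of g] by (simp add: Lp_norm_def real_of_ereal_pos)

lemma Lp_bdd_imp_memLp:
  assumes "Lp_bdd p g A" "1 \<le> p"
  shows "memLp p g \<and> Lp_norm p g \<le> A"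
proof (cases "p = \<infinity>")
  case True
  have m [measurable]: "g \<in> borel_measurable lebesgue"
    using assms by (auto simp: Lp_bdd_def intro: measurable_completion)
  have le: "esssup lebesgue (\<lambda>x. ereal \<bar>g x\<bar>) \<le> ereal A"
    using assms True by (intro esssup_I) (auto simp: Lp_bdd_def)
  then have "esssup lebesgue (\<lambda>x. ereal \<bar>g x\<bar>) < \<infinity>" by (auto simp: le_less_trans)
  moreover have "real_of_ereal (esssup lebesgue (\<lambda>x. ereal \<bar>g x\<bar>)) \<le> A"
    using le assms(1) by (cases "esssup lebesgue (\<lambda>x. ereal \<bar>g x\<bar>)") (auto simp: Lp_bdd_def)
  ultimately show ?thesis using m True by (simp add: memLp_def Lp_norm_def)
next
  case False
  define q where "q = real_of_ereal p"
  have q: "1 \<le> q" unfolding q_def using assms False by (cases p) (auto simp: one_ereal_def)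
  have mb [measurable]: "g \<in> borel_measurable borel" using assms by (simp add: Lp_bdd_def)
  have m: "g \<in> borel_measurable lebesgue" by (intro measurable_completion) simp
  have A: "0 \<le> A" using assms by (simp add: Lp_bdd_def)
  have b: "(\<integral>\<^sup>+x. ennreal (\<bar>g x\<bar> powr q) \<partial>lborel) \<le> ennreal (A powr q)"
    using assms False by (simp add: Lp_bdd_def q_def)
  have i: "integrable lborel (\<lambda>x. \<bar>g x\<bar> powr q)"
    using b by (intro integrableI_nonneg) (auto simp: le_less_trans[OF _ ennreal_less_top])
  then have il: "integrable lebesgue (\<lambda>x. \<bar>g x\<bar> powr q)"
    by (subst integrable_completion) auto
  have "ennreal (\<integral>x. \<bar>g x\<bar> powr q \<partial>lborel) \<le> ennreal (A powr q)"
    using b i by (subst (asm) nn_integral_eq_integral) auto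
  then have "(\<integral>x. \<bar>g x\<bar> powr q \<partial>lborel) \<le> A powr q" by simp
  then have "(\<integral>x. \<bar>g x\<bar> powr q \<partial>lborel) powr (1 / q) \<le> (A powr q) powr (1 / q)"
    using q by (intro powr_mono2) auto
  also have "\<dots> = A" using A q by (simp add: powr_powr)
  finally have "(\<integral>x. \<bar>g x\<bar> powr q \<partial>lebesgue) powr (1 / q) \<le> A"
    by (subst integral_completion) auto
  then show ?thesis using m il False by (simp add: memLp_def Lp_norm_def q_def)
qed

text \<open>A Borel version of \<open>G\<close> makes the dilates \<open>G (y / t)\<close> jointly
  measurable in \<open>t\<close> and \<open>y\<close>, as Fubini's theorem requires. It comes from
  the definition of Lebesgue measure as a completion.\<close>

lemma memLp_borel_representative:
  fixes G :: "'a::euclidean_space \<Rightarrow> real"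
  assumes G: "memLp p G" and p: "1 \<le> p"
  obtains G' where "Lp_bdd p G' (Lp_norm p G)" "AE x in lborel. G x = G' x"
proof -
  have m: "G \<in> borel_measurable lebesgue" using G by (simp add: memLp_def)
  then obtain H where H [measurable]: "H \<in> borel_measurable lborel" and ae: "AE x in lborel. G x = H x"
    using completion_ex_borel_measurable_real by blast
  show ?thesis
  proof (cases "p = \<infinity>")
    case False
    define q where "q = real_of_ereal p"
    have q: "1 \<le> q" unfolding q_def using p False by (cases p) (auto simp: one_ereal_def)
    have i: "integrable lebesgue (\<lambda>x. \<bar>G x\<bar> powr q)" using G False by (simp add: memLp_def q_def)
    have "(\<integral>\<^sup>+x. ennreal (\<bar>H x\<bar> powr q) \<partial>lborel) = (\<integral>\<^sup>+x. ennreal (\<bar>G x\<bar> powr q) \<partial>lborel)"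
      using ae by (intro nn_integral_cong_AE) (auto elim: eventually_mono)
    also have "\<dots> = (\<integral>\<^sup>+x. ennreal (\<bar>G x\<bar> powr q) \<partial>lebesgue)"
      by (simp add: nn_integral_completion)
    also have "\<dots> = ennreal (\<integral>x. \<bar>G x\<bar> powr q \<partial>lebesgue)"
      using i by (subst nn_integral_eq_integral) auto
    also have "\<dots> = ennreal (Lp_norm p G powr q)"
      using False q by (simp add: Lp_norm_def powr_powr q_def)
    finally show ?thesis
      using False H ae Lp_norm_nonneg[of p G] by (intro that[of H]) (auto simp: Lp_bdd_def q_def)
  next
    case True
    define A where "A = Lp_norm p G"
    have A: "ereal A = esssup lebesgue (\<lambda>x. ereal \<bar>G x\<bar>)"
    proof -
      have "esssup lebesgue (\<lambda>x. ereal \<bar>G x\<bar>) < \<infinity>" using G True by (simp add: memLp_def)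
      then show ?thesis unfolding A_def Lp_norm_def using True esssup_abs_nonneg[of G]
        by (cases "esssup lebesgue (\<lambda>x. ereal \<bar>G x\<bar>)") auto
    qed
    have "AE x in lebesgue. ereal \<bar>G x\<bar> \<le> ereal A" unfolding A by (rule esssup_AE)
    then have "AE x in lborel. \<bar>G x\<bar> \<le> A" by (simp add: AE_completion_iff)
    \<comment> \<open>Setting the representative to 0 on the null set where it exceeds the essential
      supremum turns the almost-everywhere bound into one that holds everywhere.\<close>
    with ae have "AE x in lborel. G x = (if \<bar>H x\<bar> \<le> A then H x else 0)"
      by eventually_elim auto
    then show ?thesis using True Lp_norm_nonneg[of p G]
      by (intro that[of "\<lambda>x. if \<bar>H x\<bar> \<le> A then H x else 0"]) (auto simp: Lp_bdd_def A_def)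
  qed
qed

section \<open>Boundedness of averages of dilates on \<open>L^p\<close>\<close>

lemma borel_measurable_dil_avg:
  fixes g :: "'a::euclidean_space \<Rightarrow> real"
  assumes [measurable]: "u \<in> borel_measurable borel" "g \<in> borel_measurable borel"
  shows "dil_avg u g \<in> borel_measurable borel"
  unfolding dil_avg_def[abs_def] by measurable

text \<open>Splits the Jacobian factor into the weight from \<open>kernel\<close> and the factor
  that makes the dilation isometric.\<close>

lemma power_eq_powr_mult:
  fixes t a :: real
  assumes "0 < t"
  shows "1 / t ^ n = t powr (a - real n) * t powr (- a)"
  using assms by (simp add: powr_realpow[symmetric] powr_add[symmetric] powr_minus_divide[symmetric])

text \<open>Minkowski's integral inequality. For finite \<open>p\<close>, Jensen's inequality for
  the measure \<open>k t dt\<close> bounds the \<open>q\<close>-th power pointwise; Tonelli and the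
  isometry of normalised dilations then give \<open>C powr (q - 1) * C * A powr q\<close>. For
  infinite \<open>p\<close> the pointwise bound on \<open>g\<close> is integrated directly.\<close>

lemma Lp_bdd_dil_avg:
  fixes g :: "'a::euclidean_space \<Rightarrow> real"
  assumes g: "Lp_bdd p g A" and k: "kernel TYPE('a) p u C" and p: "1 \<le> p"
  shows "Lp_bdd p (dil_avg u g) (C * A)"
proof -
  define N where "N = DIM('a)"
  define a where "a = dil_exp TYPE('a) p"
  define k where "k t = u t * t powr (a - real N)" for t
  have [measurable]: "u \<in> borel_measurable borel" "g \<in> borel_measurable borel"
    and u: "\<And>t. 0 \<le> u t" "\<And>t. t \<le> 0 \<Longrightarrow> u t = 0" and C: "0 < C" and A: "0 \<le> A"
    and kC: "(\<integral>\<^sup>+t. ennreal (k t) \<partial>lborel) \<le> ennreal C"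
    using g k unfolding kernel_def Lp_bdd_def k_def a_def N_def by auto
  have [measurable]: "k \<in> borel_measurable borel" unfolding k_def[abs_def] by measurable
  have k0: "0 \<le> k t" for t unfolding k_def using u by auto
  have uk: "u t / t ^ N = k t * t powr (- a)" for t
  proof (cases "0 < t")
    case True
    then show ?thesis using power_eq_powr_mult[OF True, of N a] unfolding k_def
      by (simp add: field_simps)
  qed (use u in \<open>auto simp: k_def\<close>)
  have m: "dil_avg u g \<in> borel_measurable borel" by (intro borel_measurable_dil_avg) auto
  have le: "\<bar>dil_avg u g y\<bar> \<le> (\<integral>t. k t * (t powr (- a) * \<bar>g ((1 / t) *\<^sub>R y)\<bar>) \<partial>lborel)" for y
  proof -
    have "\<bar>dil_avg u g y\<bar> \<le> (\<integral>t. \<bar>u t / t ^ N * g ((1 / t) *\<^sub>R y)\<bar> \<partial>lborel)"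
      unfolding dil_avg_def N_def by (rule integral_abs_bound)
    also have "(\<lambda>t. \<bar>u t / t ^ N * g ((1 / t) *\<^sub>R y)\<bar>)
        = (\<lambda>t. k t * (t powr (- a) * \<bar>g ((1 / t) *\<^sub>R y)\<bar>))"
      unfolding uk by (auto simp: abs_mult k0 mult.assoc)
    finally show ?thesis .
  qed
  show ?thesis
  proof (cases "p = \<infinity>")
    case True
    then have a0: "a = 0" by (simp add: a_def dil_exp_def)
    have gA: "\<bar>g x\<bar> \<le> A" for x using g True by (simp add: Lp_bdd_def)
    have ik: "integrable lborel k"
      using kC k0 by (auto intro!: integrableI_nonneg simp: le_less_trans[OF _ ennreal_less_top])
    have "ennreal (integral\<^sup>L lborel k) \<le> ennreal C"
      using kC ik k0 by (subst (asm) nn_integral_eq_integral) auto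
    then have ikC: "integral\<^sup>L lborel k \<le> C" using C by simp
    have "\<bar>dil_avg u g y\<bar> \<le> C * A" for y
    proof -
      have "\<bar>dil_avg u g y\<bar> \<le> (\<integral>t. k t * (t powr (- a) * \<bar>g ((1 / t) *\<^sub>R y)\<bar>) \<partial>lborel)" by (rule le)
      also have "\<dots> \<le> (\<integral>t. k t * A \<partial>lborel)"
      proof (rule integral_mono_AE')
        show "AE t in lborel. k t * (t powr - a * \<bar>g ((1 / t) *\<^sub>R y)\<bar>) \<le> k t * A"
          using gA k0 A by (auto intro!: AE_I2 mult_left_mono simp: a0)
      qed (use ik k0 A in auto)
      also have "\<dots> \<le> C * A" using ikC A by (simp add: mult_right_mono)
      finally show ?thesis .
    qed
    then show ?thesis using m C A True by (simp add: Lp_bdd_def)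
  next
    case False
    define q where "q = real_of_ereal p"
    have q: "1 \<le> q" unfolding q_def using p False by (cases p) (auto simp: one_ereal_def)
    have aq: "a * q = real N" using q unfolding a_def dil_exp_def q_def N_def by simp
    have gA: "(\<integral>\<^sup>+x. ennreal (\<bar>g x\<bar> powr q) \<partial>lborel) \<le> ennreal (A powr q)"
      using g False by (simp add: Lp_bdd_def q_def)
    have "(\<integral>\<^sup>+y. ennreal (\<bar>dil_avg u g y\<bar> powr q) \<partial>lborel)
        \<le> (\<integral>\<^sup>+y. ennreal (C powr (q - 1)) *
             (\<integral>\<^sup>+t. ennreal (k t * (t powr (- a) * \<bar>g ((1 / t) *\<^sub>R y)\<bar>) powr q) \<partial>lborel) \<partial>lborel)"
    proof (rule nn_integral_mono)
      fix y
      have "ennreal (\<bar>dil_avg u g y\<bar> powr q)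
          \<le> ennreal ((\<integral>t. k t * (t powr (- a) * \<bar>g ((1 / t) *\<^sub>R y)\<bar>) \<partial>lborel) powr q)"
        using le[of y] q by (intro ennreal_leI powr_mono2) auto
      also have "\<dots> \<le> ennreal (C powr (q - 1)) *
             (\<integral>\<^sup>+t. ennreal (k t * (t powr (- a) * \<bar>g ((1 / t) *\<^sub>R y)\<bar>) powr q) \<partial>lborel)"
        by (rule powr_integral_le) (use k0 C kC q in auto)
      finally show "ennreal (\<bar>dil_avg u g y\<bar> powr q) \<le> ennreal (C powr (q - 1)) *
             (\<integral>\<^sup>+t. ennreal (k t * (t powr (- a) * \<bar>g ((1 / t) *\<^sub>R y)\<bar>) powr q) \<partial>lborel)" .
    qed
    also have "\<dots> = ennreal (C powr (q - 1)) * (\<integral>\<^sup>+y.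
             (\<integral>\<^sup>+t. ennreal (k t * (t powr (- a) * \<bar>g ((1 / t) *\<^sub>R y)\<bar>) powr q) \<partial>lborel) \<partial>lborel)"
      by (intro nn_integral_cmult) measurable
    \<comment> \<open>With the integral over \<open>y\<close> performed first, the isometry removes
      every dependence on \<open>t\<close> except the weight \<open>k t\<close>.\<close>
    also have "(\<integral>\<^sup>+y. (\<integral>\<^sup>+t. ennreal (k t * (t powr (- a) * \<bar>g ((1 / t) *\<^sub>R y)\<bar>) powr q) \<partial>lborel) \<partial>lborel)
      = (\<integral>\<^sup>+t. (\<integral>\<^sup>+y. ennreal (k t * (t powr (- a) * \<bar>g ((1 / t) *\<^sub>R y)\<bar>) powr q) \<partial>lborel) \<partial>lborel)"
      by (intro lborel_pair.Fubini') measurable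
    also have "\<dots> = (\<integral>\<^sup>+t. ennreal (k t) * (\<integral>\<^sup>+x. ennreal (\<bar>g x\<bar> powr q) \<partial>lborel) \<partial>lborel)"
    proof (rule nn_integral_cong)
      fix t :: real
      show "(\<integral>\<^sup>+y. ennreal (k t * (t powr (- a) * \<bar>g ((1 / t) *\<^sub>R y)\<bar>) powr q) \<partial>lborel)
          = ennreal (k t) * (\<integral>\<^sup>+x. ennreal (\<bar>g x\<bar> powr q) \<partial>lborel)"
      proof (cases "0 < t")
        case True
        have "(\<integral>\<^sup>+y. ennreal (k t * (t powr (- a) * \<bar>g ((1 / t) *\<^sub>R y)\<bar>) powr q) \<partial>lborel)
          = ennreal (k t) * (\<integral>\<^sup>+y. ennreal ((t powr (- a) * \<bar>g ((1 / t) *\<^sub>R y)\<bar>) powr q) \<partial>lborel)"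
          using k0 by (simp add: ennreal_mult nn_integral_cmult)
        also have "\<dots> = ennreal (k t) * (\<integral>\<^sup>+x. ennreal (\<bar>g x\<bar> powr q) \<partial>lborel)"
          using True aq by (subst nn_integral_dilation_powr) (auto simp: N_def)
        finally show ?thesis .
      next
        case False
        then have "k t = 0" using u by (simp add: k_def)
        then show ?thesis by simp
      qed
    qed
    also have "\<dots> = (\<integral>\<^sup>+t. ennreal (k t) \<partial>lborel) * (\<integral>\<^sup>+x. ennreal (\<bar>g x\<bar> powr q) \<partial>lborel)"
      by (rule nn_integral_multc) measurable
    also have "ennreal (C powr (q - 1)) * \<dots> \<le> ennreal (C powr (q - 1)) * (ennreal C * ennreal (A powr q))"
      using kC gA by (intro mult_left_mono mult_mono) auto
    also have "\<dots> = ennreal ((C * A) powr q)"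
    proof -
      have "C powr (q - 1) * C = C powr q" using C by (simp add: powr_mult_base mult.commute)
      then have "C powr (q - 1) * (C * A powr q) = (C * A) powr q"
        using C A by (simp add: powr_mult mult.assoc[symmetric])
      then show ?thesis using C by (simp add: ennreal_mult[symmetric])
    qed
    finally show ?thesis using m C A False by (simp add: Lp_bdd_def q_def)
  qed
qed


section \<open>Duality between averages of dilates and integrals along rays\<close>

text \<open>For fixed \<open>t\<close> the substitution \<open>y = t x\<close> moves the dilation
  from \<open>g\<close> to the test function, and Fubini exchanges the order of integration. The
  work lies in absolute integrability on the product.\<close>

lemma dil_avg_pairing:
  fixes g \<psi> :: "'a::euclidean_space \<Rightarrow> real"
  assumes g: "Lp_bdd p g A" and k: "kernel TYPE('a) p u C" and p: "1 \<le> p"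
    and [measurable]: "\<psi> \<in> borel_measurable borel"
    and B: "\<And>x. \<bar>\<psi> x\<bar> \<le> B" and R: "\<And>x. R < norm x \<Longrightarrow> \<psi> x = 0"
  shows "integrable lborel (\<lambda>x. g x * (\<integral>t. u t * \<psi> (t *\<^sub>R x) \<partial>lborel))"
    and "(\<integral>x. dil_avg u g x * \<psi> x \<partial>lborel) = (\<integral>x. g x * (\<integral>t. u t * \<psi> (t *\<^sub>R x) \<partial>lborel) \<partial>lborel)"
proof -
  define N where "N = DIM('a)"
  define a where "a = dil_exp TYPE('a) p"
  have [measurable]: "u \<in> borel_measurable borel" "g \<in> borel_measurable borel"
    and u: "\<And>t. 0 \<le> u t" "\<And>t. t \<le> 0 \<Longrightarrow> u t = 0" and C: "0 < C" and A: "0 \<le> A"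
    and kC: "(\<integral>\<^sup>+t. ennreal (u t * t powr (a - real N)) \<partial>lborel) \<le> ennreal C"
    using g k unfolding kernel_def Lp_bdd_def a_def N_def by auto
  have B0: "0 \<le> B" using B[of 0] by auto
  define K0 where "K0 = B * measure lborel (cball (0::'a) R)"
  have ball: "(\<integral>\<^sup>+y. ennreal (B * indicator (cball (0::'a) R) y) \<partial>lborel) = ennreal K0"
  proof -
    have "(\<integral>\<^sup>+y. ennreal (B * indicator (cball (0::'a) R) y) \<partial>lborel)
        = (\<integral>\<^sup>+y. ennreal B * indicator (cball (0::'a) R) y \<partial>lborel)"
      using B0 by (intro nn_integral_cong) (auto split: split_indicator)
    also have "\<dots> = ennreal B * emeasure lborel (cball (0::'a) R)" by (simp add: nn_integral_cmult_indicator)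
    also have "\<dots> = ennreal K0"
      unfolding K0_def using B0 emeasure_bounded_finite[OF bounded_cball, of "0::'a" R]
      by (subst emeasure_eq_ennreal_measure) (auto simp: ennreal_mult)
    finally show ?thesis .
  qed
  have [measurable]: "cball (0::'a) R \<in> sets borel" by simp
  have Bi: "\<bar>\<psi> y\<bar> \<le> B * indicator (cball (0::'a) R) y" for y
    using B[of y] R[of y] by (auto split: split_indicator)
  have K00: "0 \<le> K0" using B0 by (simp add: K0_def)
  \<comment> \<open>Any finite \<open>K\<close> will do; what matters is the growth
    \<open>t powr a\<close>, which together with the Jacobian factor is exactly what the kernel
    condition integrates. For finite \<open>p\<close> the bound comes from
    \<open>z \<le> 1 + z powr q\<close> applied to the normalised dilate, with the 1 localised to
    the support of the test function.\<close>
  obtain K where K0: "0 \<le> K" and K: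
    "\<And>t. 0 < t \<Longrightarrow> (\<integral>\<^sup>+y. ennreal (\<bar>g ((1 / t) *\<^sub>R y)\<bar> * \<bar>\<psi> y\<bar>) \<partial>lborel) \<le> ennreal (K * t powr a)"
  proof (cases "p = \<infinity>")
    case True
    then have gA: "\<bar>g x\<bar> \<le> A" for x using g by (simp add: Lp_bdd_def)
    have a0: "a = 0" using True by (simp add: a_def dil_exp_def)
    have "(\<integral>\<^sup>+y. ennreal (\<bar>g ((1 / t) *\<^sub>R y)\<bar> * \<bar>\<psi> y\<bar>) \<partial>lborel) \<le> ennreal ((A * K0) * t powr a)" if "0 < t" for t
    proof -
      have "(\<integral>\<^sup>+y. ennreal (\<bar>g ((1 / t) *\<^sub>R y)\<bar> * \<bar>\<psi> y\<bar>) \<partial>lborel)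
          \<le> (\<integral>\<^sup>+y. ennreal (A * (B * indicator (cball (0::'a) R) y)) \<partial>lborel)"
        using gA Bi A by (intro nn_integral_mono ennreal_leI mult_mono) auto
      also have "\<dots> = (\<integral>\<^sup>+y. ennreal A * ennreal (B * indicator (cball (0::'a) R) y) \<partial>lborel)"
        using A B0 by (simp add: ennreal_mult)
      also have "\<dots> = ennreal (A * K0)"
        using A K00 by (subst nn_integral_cmult) (auto simp: ball ennreal_mult)
      finally show ?thesis using that a0 by simp
    qed
    then show ?thesis using that[of "A * K0"] A K00 by auto
  next
    case False
    define q where "q = real_of_ereal p"
    have q: "1 \<le> q" unfolding q_def using p False by (cases p) (auto simp: one_ereal_def)
    have aq: "a * q = real N" using q unfolding a_def dil_exp_def q_def N_def by simp
    have gA: "(\<integral>\<^sup>+x. ennreal (\<bar>g x\<bar> powr q) \<partial>lborel) \<le> ennreal (A powr q)"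
      using g False by (simp add: Lp_bdd_def q_def)
    define K where "K = K0 + B * A powr q"
    have "(\<integral>\<^sup>+y. ennreal (\<bar>g ((1 / t) *\<^sub>R y)\<bar> * \<bar>\<psi> y\<bar>) \<partial>lborel) \<le> ennreal (K * t powr a)" if t: "0 < t" for t
    proof -
      have ta: "t powr (- a) * t powr a = 1" using t by (simp add: powr_add[symmetric])
      have pt: "\<bar>g ((1 / t) *\<^sub>R y)\<bar> * \<bar>\<psi> y\<bar>
         \<le> t powr a * (B * indicator (cball 0 R) y + B * (t powr (- a) * \<bar>g ((1 / t) *\<^sub>R y)\<bar>) powr q)" for y
      proof -
        define z where "z = t powr (- a) * \<bar>g ((1 / t) *\<^sub>R y)\<bar>"
        have z0: "0 \<le> z" unfolding z_def by simp
        have z1: "z \<le> 1 + z powr q" using z0 q by (rule le_one_plus_powr)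
        have "\<bar>\<psi> y\<bar> * z \<le> \<bar>\<psi> y\<bar> * (1 + z powr q)" using z1 by (intro mult_left_mono) auto
        also have "\<dots> = \<bar>\<psi> y\<bar> + \<bar>\<psi> y\<bar> * z powr q" by (simp add: algebra_simps)
        also have "\<dots> \<le> B * indicator (cball 0 R) y + B * z powr q"
          using Bi B by (intro add_mono mult_right_mono) auto
        finally have "t powr a * (\<bar>\<psi> y\<bar> * z) \<le> t powr a * (B * indicator (cball 0 R) y + B * z powr q)"
          by (intro mult_left_mono) auto
        moreover have "t powr a * (\<bar>\<psi> y\<bar> * z) = (t powr (- a) * t powr a) * (\<bar>g ((1 / t) *\<^sub>R y)\<bar> * \<bar>\<psi> y\<bar>)"
          unfolding z_def by (simp add: algebra_simps)
        ultimately show ?thesis unfolding ta z_def by simp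
      qed
      have sc: "(\<integral>\<^sup>+y. ennreal ((t powr (- a) * \<bar>g ((1 / t) *\<^sub>R y)\<bar>) powr q) \<partial>lborel) \<le> ennreal (A powr q)"
        using gA t aq by (subst nn_integral_dilation_powr) (auto simp: N_def)
      have "(\<integral>\<^sup>+y. ennreal (\<bar>g ((1 / t) *\<^sub>R y)\<bar> * \<bar>\<psi> y\<bar>) \<partial>lborel)
         \<le> (\<integral>\<^sup>+y. ennreal (t powr a * (B * indicator (cball 0 R) y + B * (t powr (- a) * \<bar>g ((1 / t) *\<^sub>R y)\<bar>) powr q)) \<partial>lborel)"
        using pt by (intro nn_integral_mono ennreal_leI) auto
      also have "\<dots> = (\<integral>\<^sup>+y. ennreal (t powr a) * (ennreal (B * indicator (cball 0 R) y) +
           ennreal B * ennreal ((t powr (- a) * \<bar>g ((1 / t) *\<^sub>R y)\<bar>) powr q)) \<partial>lborel)"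
        using B0 by (simp add: ennreal_mult ennreal_plus)
      also have "\<dots> = ennreal (t powr a) * ((\<integral>\<^sup>+y. ennreal (B * indicator (cball (0::'a) R) y) \<partial>lborel) +
           ennreal B * (\<integral>\<^sup>+y. ennreal ((t powr (- a) * \<bar>g ((1 / t) *\<^sub>R y)\<bar>) powr q) \<partial>lborel))"
        by (simp add: nn_integral_cmult nn_integral_add)
      also have "\<dots> \<le> ennreal (t powr a) * (ennreal K0 + ennreal B * ennreal (A powr q))"
        unfolding ball using sc by (intro mult_left_mono add_left_mono) auto
      also have "\<dots> = ennreal (K * t powr a)"
        unfolding K_def using B0 K00 by (simp add: ennreal_mult[symmetric] ennreal_plus[symmetric] mult.commute del: ennreal_plus)
      finally show ?thesis .
    qed
    then show ?thesis using that[of K] B0 K00 by (auto simp: K_def)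
  qed
  \<comment> \<open>\<open>H\<close> is the integrand in the variable \<open>y\<close>, and
    \<open>H2\<close> is the same integrand after \<open>y = t x\<close> with the Jacobian
    absorbed.\<close>
  define H where "H t y = u t / t ^ N * g ((1 / t) *\<^sub>R y) * \<psi> y" for t y
  define H2 where "H2 t x = u t * g x * \<psi> (t *\<^sub>R x)" for t x
  have [measurable]: "case_prod H \<in> borel_measurable (borel \<Otimes>\<^sub>M borel)"
      "case_prod H2 \<in> borel_measurable (borel \<Otimes>\<^sub>M borel)"
    unfolding H_def[abs_def] H2_def[abs_def] by measurable
  have Hm: "H t \<in> borel_measurable borel" for t unfolding H_def[abs_def] by measurable
  have HH2: "t ^ N * H t (t *\<^sub>R x) = H2 t x" if "0 < t" for t x
    using that unfolding H_def H2_def by simp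
  have z: "H t y = 0" "H2 t y = 0" if "\<not> 0 < t" for t y using that u unfolding H_def H2_def by auto
  have nnH: "(\<integral>\<^sup>+y. ennreal \<bar>H t y\<bar> \<partial>lborel) = (\<integral>\<^sup>+x. ennreal \<bar>H2 t x\<bar> \<partial>lborel)" for t
  proof (cases "0 < t")
    case True
    have "(\<integral>\<^sup>+y. ennreal \<bar>H t y\<bar> \<partial>lborel) = ennreal (t ^ N) * (\<integral>\<^sup>+x. ennreal \<bar>H t (t *\<^sub>R x)\<bar> \<partial>lborel)"
      unfolding N_def using True Hm[of t] by (intro nn_integral_lborel_scaleR) measurable
    also have "\<dots> = (\<integral>\<^sup>+x. ennreal (t ^ N) * ennreal \<bar>H t (t *\<^sub>R x)\<bar> \<partial>lborel)"
      using Hm[of t] by (intro nn_integral_cmult[symmetric]) measurable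
    also have "\<dots> = (\<integral>\<^sup>+x. ennreal \<bar>H2 t x\<bar> \<partial>lborel)"
      using True by (simp add: ennreal_mult[symmetric] HH2[OF True, symmetric] abs_mult)
    finally show ?thesis .
  qed (simp add: z)
  have nnHb: "(\<integral>\<^sup>+y. ennreal \<bar>H t y\<bar> \<partial>lborel) \<le> ennreal K * ennreal (u t * t powr (a - real N))" for t
  proof (cases "0 < t")
    case True
    have "(\<integral>\<^sup>+y. ennreal \<bar>H t y\<bar> \<partial>lborel)
        = (\<integral>\<^sup>+y. ennreal (u t / t ^ N) * ennreal (\<bar>g ((1 / t) *\<^sub>R y)\<bar> * \<bar>\<psi> y\<bar>) \<partial>lborel)"
      unfolding H_def using True u by (simp add: ennreal_mult[symmetric] abs_mult mult.assoc)
    also have "\<dots> = ennreal (u t / t ^ N) * (\<integral>\<^sup>+y. ennreal (\<bar>g ((1 / t) *\<^sub>R y)\<bar> * \<bar>\<psi> y\<bar>) \<partial>lborel)"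
      by (rule nn_integral_cmult) measurable
    also have "\<dots> \<le> ennreal (u t / t ^ N) * ennreal (K * t powr a)"
      using K[OF True] by (intro mult_left_mono) auto
    also have "\<dots> = ennreal K * ennreal (u t * t powr (a - real N))"
      using True u K0 by (simp add: ennreal_mult[symmetric] powr_diff powr_realpow field_simps)
    finally show ?thesis .
  qed (simp add: z)
  have fin: "(\<integral>\<^sup>+t. \<integral>\<^sup>+y. ennreal \<bar>H t y\<bar> \<partial>lborel \<partial>lborel) < \<infinity>"
  proof -
    have "(\<integral>\<^sup>+t. \<integral>\<^sup>+y. ennreal \<bar>H t y\<bar> \<partial>lborel \<partial>lborel)
        \<le> (\<integral>\<^sup>+t. ennreal K * ennreal (u t * t powr (a - real N)) \<partial>lborel)"
      using nnHb by (intro nn_integral_mono) auto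
    also have "\<dots> = ennreal K * (\<integral>\<^sup>+t. ennreal (u t * t powr (a - real N)) \<partial>lborel)"
      by (rule nn_integral_cmult) measurable
    also have "\<dots> \<le> ennreal K * ennreal C" using kC by (intro mult_left_mono) auto
    also have "\<dots> < \<infinity>" by (simp add: ennreal_mult_less_top)
    finally show ?thesis .
  qed
  have iH: "integrable (lborel \<Otimes>\<^sub>M lborel) (case_prod H)"
  proof (rule integrableI_bounded)
    have "(\<integral>\<^sup>+z. ennreal (norm (case_prod H z)) \<partial>(lborel \<Otimes>\<^sub>M lborel))
        = (\<integral>\<^sup>+t. \<integral>\<^sup>+y. ennreal \<bar>H t y\<bar> \<partial>lborel \<partial>lborel)"
      by (subst lborel.nn_integral_fst[symmetric]) auto
    then show "(\<integral>\<^sup>+z. ennreal (norm (case_prod H z)) \<partial>(lborel \<Otimes>\<^sub>M lborel)) < \<infinity>" using fin by simp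
  qed measurable
  have iH2: "integrable (lborel \<Otimes>\<^sub>M lborel) (case_prod H2)"
  proof (rule integrableI_bounded)
    have "(\<integral>\<^sup>+z. ennreal (norm (case_prod H2 z)) \<partial>(lborel \<Otimes>\<^sub>M lborel))
        = (\<integral>\<^sup>+t. \<integral>\<^sup>+y. ennreal \<bar>H2 t y\<bar> \<partial>lborel \<partial>lborel)"
      by (subst lborel.nn_integral_fst[symmetric]) auto
    then show "(\<integral>\<^sup>+z. ennreal (norm (case_prod H2 z)) \<partial>(lborel \<Otimes>\<^sub>M lborel)) < \<infinity>"
      using fin by (simp add: nnH)
  qed measurable
  have eq2: "(\<integral>t. H2 t x \<partial>lborel) = g x * (\<integral>t. u t * \<psi> (t *\<^sub>R x) \<partial>lborel)" for x
    unfolding H2_def by (subst integral_mult_right_zero[symmetric]) (simp add: ac_simps)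
  show "integrable lborel (\<lambda>x. g x * (\<integral>t. u t * \<psi> (t *\<^sub>R x) \<partial>lborel))"
    using lborel_pair.integrable_snd[OF iH2] by (simp add: eq2)
  have "(\<integral>x. dil_avg u g x * \<psi> x \<partial>lborel) = (\<integral>x. (\<integral>t. H t x \<partial>lborel) \<partial>lborel)"
    by (simp only: dil_avg_def H_def N_def integral_mult_left_zero)
  also have "\<dots> = (\<integral>t. (\<integral>x. H t x \<partial>lborel) \<partial>lborel)"
    by (rule lborel_pair.Fubini_integral[OF iH])
  also have "\<dots> = (\<integral>t. (\<integral>x. H2 t x \<partial>lborel) \<partial>lborel)"
  proof (rule Bochner_Integration.integral_cong)
    fix t :: real
    show "(\<integral>x. H t x \<partial>lborel) = (\<integral>x. H2 t x \<partial>lborel)"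
    proof (cases "0 < t")
      case True
      show ?thesis using True Hm[of t] integral_lborel_scaleR[of "H t" t]
        by (simp add: HH2[OF True, symmetric] N_def)
    qed (simp add: z)
  qed simp
  also have "\<dots> = (\<integral>x. (\<integral>t. H2 t x \<partial>lborel) \<partial>lborel)"
    by (rule lborel_pair.Fubini_integral[OF iH2, symmetric])
  finally show "(\<integral>x. dil_avg u g x * \<psi> x \<partial>lborel) = (\<integral>x. g x * (\<integral>t. u t * \<psi> (t *\<^sub>R x) \<partial>lborel) \<partial>lborel)"
    by (simp add: eq2)
qed

section \<open>Admissibility of the kernels from Taylor's formula\<close>

lemma nn_integral_powr_unit:
  fixes c :: real
  assumes "-1 < c"
  shows "(\<integral>\<^sup>+t. ennreal (indicator {0<..<1} t * t powr c) \<partial>lborel) \<le> ennreal (1 / (c + 1))"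
proof -
  have "((\<lambda>t. t powr c) has_integral (1 powr (c + 1) / (c + 1))) {0..1}"
    by (rule has_integral_powr_from_0) (use assms in auto)
  then have "(\<integral>\<^sup>+t. ennreal (indicator {0..1} t * t powr c) \<partial>lborel) = ennreal (1 / (c + 1))"
    by (subst nn_integral_has_integral_lebesgue[where \<Omega> = "{0..1}" and I = "1 / (c + 1)"])
       auto
  moreover have "(\<integral>\<^sup>+t. ennreal (indicator {0<..<1} t * t powr c) \<partial>lborel)
      \<le> (\<integral>\<^sup>+t. ennreal (indicator {0..1} t * t powr c) \<partial>lborel)"
    by (intro nn_integral_mono ennreal_leI mult_right_mono) (auto split: split_indicator)
  ultimately show ?thesis by simp
qed

text \<open>The hypothesis is integrability of \<open>t powr (dil_exp - DIM)\<close> at 0. Since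
  \<open>1 - t\<close> is at most 1 on the unit interval, one constant serves both kernels, so a
  single \<open>C\<close> can bound both \<open>F\<close> and \<open>F1\<close>.\<close>

lemma kernel_unit:
  assumes "real DIM('a::euclidean_space) - 1 < dil_exp TYPE('a) p"
  obtains C where "kernel TYPE('a) p (indicator {0<..<1}) C"
    "kernel TYPE('a) p (\<lambda>t. indicator {0<..<1} t * (1 - t)) C"
proof -
  define c where "c = dil_exp TYPE('a) p - real DIM('a)"
  have c: "-1 < c" using assms by (simp add: c_def)
  note b = nn_integral_powr_unit[OF c]
  have "(\<integral>\<^sup>+t. ennreal (indicator {0<..<1} t * (1 - t) * t powr c) \<partial>lborel)
      \<le> (\<integral>\<^sup>+t. ennreal (indicator {0<..<1} t * t powr c) \<partial>lborel)"
    by (intro nn_integral_mono ennreal_leI mult_right_mono) (auto split: split_indicator)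
  with b have b2: "(\<integral>\<^sup>+t. ennreal (indicator {0<..<1} t * (1 - t) * t powr c) \<partial>lborel) \<le> ennreal (1 / (c + 1))"
    by (rule order_trans[rotated])
  show ?thesis
    using b b2 c by (intro that[of "1 / (c + 1)"])
      (auto simp: kernel_def c_def split: split_indicator)
qed

text \<open>Bounding \<open>t - 1\<close> by \<open>t\<close> leaves the tail integral of
  \<open>t powr (c + 1)\<close> with \<open>c = dil_exp - DIM\<close>; it converges for
  \<open>c + 2 < 0\<close>, with value \<open>- 1 / (c + 2)\<close>.\<close>

lemma kernel_tail:
  assumes "dil_exp TYPE('a) p < real DIM('a::euclidean_space) - 2"
  obtains C where "kernel TYPE('a) p (\<lambda>t. indicator {1<..} t * (t - 1)) C"
proof -
  define c where "c = dil_exp TYPE('a) p - real DIM('a)"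
  have c: "c + 2 < 0" using assms by (simp add: c_def)
  have "(\<integral>\<^sup>+t. ennreal (indicator {1<..} t * (t - 1) * t powr c) \<partial>lborel)
      \<le> (\<integral>\<^sup>+t. ennreal (t powr (c + 1)) * indicator {1..} t \<partial>lborel)"
  proof (rule nn_integral_mono)
    fix t :: real
    show "ennreal (indicator {1<..} t * (t - 1) * t powr c) \<le> ennreal (t powr (c + 1)) * indicator {1..} t"
    proof (cases "1 < t")
      case True
      have "(t - 1) * t powr c \<le> t * t powr c" by (intro mult_right_mono) auto
      then show ?thesis using True by (simp add: powr_mult_base ennreal_leI add.commute)
    qed simp
  qed
  also have "\<dots> = ennreal (0 - 1 powr (c + 2) / (c + 2))"
  proof (rule nn_integral_FTC_atLeast)
    show "((\<lambda>t. t powr (c + 2) / (c + 2)) \<longlongrightarrow> 0) at_top"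
      using c by (intro tendsto_divide_zero tendsto_neg_powr filterlim_ident) auto
    show "((\<lambda>t. t powr (c + 2) / (c + 2)) has_real_derivative x powr (c + 1)) (at x)" if "1 \<le> x" for x
    proof -
      have "((\<lambda>t. t powr (c + 2) / (c + 2)) has_real_derivative ((c + 2) * x powr (c + 2 - 1)) / (c + 2)) (at x)"
        using that by (intro DERIV_cdivide has_real_derivative_powr) auto
      moreover have "((c + 2) * x powr (c + 2 - 1)) / (c + 2) = x powr (c + 1)"
        using c by (simp add: add_diff_eq[symmetric])
      ultimately show ?thesis by simp
    qed
  qed auto
  finally have b: "(\<integral>\<^sup>+t. ennreal (indicator {1<..} t * (t - 1) * t powr c) \<partial>lborel) \<le> ennreal (- 1 / (c + 2))"
    by simp
  show ?thesis
    using b c by (intro that[of "- 1 / (c + 2)"])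
      (auto simp: kernel_def c_def divide_neg_neg split: split_indicator)
qed

section \<open>Smooth functions and left-invariant vector fields\<close>

text \<open>Induction on the set of coordinates that are moved. The last move is controlled by the
  mean value inequality and continuity of \<open>d b\<close> at \<open>x\<close>; half of
  \<open>e\<close> is spent on it and half on the earlier moves.\<close>

lemma sum_directional_approx:
  fixes f :: "'a::euclidean_space \<Rightarrow> real"
  assumes d: "\<And>b x. b \<in> Basis \<Longrightarrow> ((\<lambda>t. f (x + t *\<^sub>R b)) has_real_derivative d b x) (at 0)"
    and cont: "\<And>b. b \<in> Basis \<Longrightarrow> continuous_on UNIV (d b)"
    and S: "finite S" "S \<subseteq> Basis" and e: "0 < e"
  shows "\<exists>\<delta>>0. \<forall>h. norm h < \<delta> \<longrightarrow>
     \<bar>f (x + (\<Sum>b\<in>S. (h \<bullet> b) *\<^sub>R b)) - f x - (\<Sum>b\<in>S. (h \<bullet> b) * d b x)\<bar> \<le> e * norm h"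
  using S e
proof (induction S arbitrary: e rule: finite_induct)
  case empty
  then show ?case by (auto intro!: exI[of _ 1])
next
  case (insert b S)
  then have b: "b \<in> Basis" by auto
  obtain \<delta>1 where \<delta>1: "\<delta>1 > 0" and IH: "\<And>h. norm h < \<delta>1 \<Longrightarrow>
     \<bar>f (x + (\<Sum>b\<in>S. (h \<bullet> b) *\<^sub>R b)) - f x - (\<Sum>b\<in>S. (h \<bullet> b) * d b x)\<bar> \<le> e / 2 * norm h"
    using insert.IH[of "e / 2"] insert.prems by auto
  have "continuous (at x) (d b)" using cont[OF b] by (simp add: continuous_on_eq_continuous_at)
  then obtain \<delta>2 where \<delta>2: "\<delta>2 > 0" and D2: "\<And>y. dist y x < \<delta>2 \<Longrightarrow> dist (d b y) (d b x) < e / 2"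
    using insert.prems unfolding continuous_at_eps_delta by (metis half_gt_zero)
  \<comment> \<open>\<open>m\<close> bounds the number of coordinate moves, each of length at most
    \<open>norm h\<close>, so every point on the path stays within \<open>m * norm h\<close> of
    \<open>x\<close>.\<close>
  define m where "m = real (card S) + 1"
  have m: "m > 0" unfolding m_def by simp
  have "\<bar>f (x + (\<Sum>b\<in>insert b S. (h \<bullet> b) *\<^sub>R b)) - f x - (\<Sum>b\<in>insert b S. (h \<bullet> b) * d b x)\<bar> \<le> e * norm h"
    if h: "norm h < min \<delta>1 (\<delta>2 / m)" for h
  proof -
    define z where "z = x + (\<Sum>b\<in>S. (h \<bullet> b) *\<^sub>R b)"
    define \<tau> where "\<tau> = h \<bullet> b"
    have \<tau>: "\<bar>\<tau>\<bar> \<le> norm h" unfolding \<tau>_def using b by (rule Basis_le_norm)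
    have der: "((\<lambda>t. f (z + t *\<^sub>R b)) has_real_derivative d b (z + t *\<^sub>R b)) (at t)" for t
      using d[OF b, of "z + t *\<^sub>R b"] DERIV_shift[of "\<lambda>t. f (z + t *\<^sub>R b)" _ 0 t]
      by (simp add: algebra_simps)
    have "norm ((f (z + \<tau> *\<^sub>R b) - \<tau> * d b x) - (f (z + 0 *\<^sub>R b) - 0 * d b x)) \<le> e / 2 * norm (\<tau> - 0)"
    proof (rule field_differentiable_bound[where S = "closed_segment 0 \<tau>"
            and f' = "\<lambda>t. d b (z + t *\<^sub>R b) - d b x" and f = "\<lambda>t. f (z + t *\<^sub>R b) - t * d b x"])
      fix t assume t: "t \<in> closed_segment 0 \<tau>"
      show "((\<lambda>t. f (z + t *\<^sub>R b) - t * d b x) has_field_derivative d b (z + t *\<^sub>R b) - d b x)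
          (at t within closed_segment 0 \<tau>)"
        by (auto intro!: derivative_eq_intros DERIV_subset[OF der])
      have t': "\<bar>t\<bar> \<le> norm h"
        using t \<tau> by (auto simp: closed_segment_eq_real_ivl split: if_splits)
      have "dist (z + t *\<^sub>R b) x = norm ((\<Sum>b\<in>S. (h \<bullet> b) *\<^sub>R b) + t *\<^sub>R b)"
        by (simp add: z_def dist_norm)
      also have "\<dots> \<le> norm (\<Sum>b\<in>S. (h \<bullet> b) *\<^sub>R b) + norm (t *\<^sub>R b)" by (rule norm_triangle_ineq)
      also have "\<dots> \<le> (\<Sum>b\<in>S. norm h) + norm h"
        using insert.prems t' b
        by (intro add_mono order_trans[OF norm_sum] sum_mono) (auto simp: Basis_le_norm)
      also have "\<dots> = m * norm h" by (simp add: m_def algebra_simps)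
      also have "\<dots> < \<delta>2" using h m by (simp add: field_simps)
      finally show "norm (d b (z + t *\<^sub>R b) - d b x) \<le> e / 2"
        using D2[of "z + t *\<^sub>R b"] by (simp add: dist_norm)
    qed auto
    then have "\<bar>f (z + \<tau> *\<^sub>R b) - f z - \<tau> * d b x\<bar> \<le> e / 2 * \<bar>\<tau>\<bar>"
      by (simp add: algebra_simps)
    also have "\<dots> \<le> e / 2 * norm h"
      using \<tau> insert.prems by (intro mult_left_mono) auto
    finally have 1: "\<bar>f (z + \<tau> *\<^sub>R b) - f z - \<tau> * d b x\<bar> \<le> e / 2 * norm h" .
    have 2: "\<bar>f z - f x - (\<Sum>b\<in>S. (h \<bullet> b) * d b x)\<bar> \<le> e / 2 * norm h"
      using IH[of h] h unfolding z_def by auto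
    have 3: "x + (\<Sum>b\<in>insert b S. (h \<bullet> b) *\<^sub>R b) = z + \<tau> *\<^sub>R b"
      "(\<Sum>b\<in>insert b S. (h \<bullet> b) * d b x) = \<tau> * d b x + (\<Sum>b\<in>S. (h \<bullet> b) * d b x)"
      using insert.hyps by (auto simp: z_def \<tau>_def)
    show ?thesis unfolding 3 using 1 2 by linarith
  qed
  then show ?case using \<delta>1 \<delta>2 m by (intro exI[of _ "min \<delta>1 (\<delta>2 / m)"]) auto
qed

text \<open>\<open>smooth\<close> speaks of iterated directional derivatives only; this bridge to
  the Frechet derivative gives access to the chain rule.\<close>

lemma has_derivative_of_directional:
  fixes f :: "'a::euclidean_space \<Rightarrow> real"
  assumes d: "\<And>b x. b \<in> Basis \<Longrightarrow> ((\<lambda>t. f (x + t *\<^sub>R b)) has_real_derivative d b x) (at 0)"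
    and cont: "\<And>b. b \<in> Basis \<Longrightarrow> continuous_on UNIV (d b)"
  shows "(f has_derivative (\<lambda>h. \<Sum>b\<in>Basis. (h \<bullet> b) * d b x)) (at x)"
  unfolding has_derivative_at_alt
proof (intro conjI allI impI)
  show "bounded_linear (\<lambda>h. \<Sum>b\<in>Basis. (h \<bullet> b) * d b x)"
    by (intro bounded_linear_sum bounded_linear_mult_const bounded_linear_inner_left)
  fix e :: real assume "0 < e"
  from sum_directional_approx[of f d Basis, OF d cont finite_Basis order_refl this, of x]
  obtain \<delta> where "\<delta> > 0" and *: "\<And>h. norm h < \<delta> \<Longrightarrow>
     \<bar>f (x + (\<Sum>b\<in>Basis. (h \<bullet> b) *\<^sub>R b)) - f x - (\<Sum>b\<in>Basis. (h \<bullet> b) * d b x)\<bar> \<le> e * norm h"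
    by auto
  then show "\<exists>\<delta>>0. \<forall>y. norm (y - x) < \<delta> \<longrightarrow>
      norm (f y - f x - (\<Sum>b\<in>Basis. (y - x) \<bullet> b * d b x)) \<le> e * norm (y - x)"
    using *[of "y - x" for y] by (intro exI[of _ \<delta>]) (auto simp: euclidean_representation)
qed

section \<open>Continuously differentiable functions\<close>

text \<open>Continuity is asked direction by direction, which in finite dimension amounts to
  continuity of the derivative. This class is enough for the fields \<open>X^b \<phi>\<close>, which
  are differentiated just once more in the second-order Taylor formulas.\<close>

definition C1 :: "('a::euclidean_space \<Rightarrow> real) \<Rightarrow> bool" where
  "C1 f \<longleftrightarrow> (\<exists>D. (\<forall>x. (f has_derivative D x) (at x)) \<and> (\<forall>v. continuous_on UNIV (\<lambda>x. D x v)))"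

lemma C1_imp_continuous: "C1 f \<Longrightarrow> continuous_on UNIV f"
  unfolding C1_def by (auto intro: has_derivative_continuous_on has_derivative_at_withinI)

lemma smooth_has_derivative:
  fixes f :: "'a::euclidean_space \<Rightarrow> real"
  assumes "smooth f"
  shows "(f has_derivative (\<lambda>h. \<Sum>b\<in>Basis. (h \<bullet> b) * iter_dd [b] f x)) (at x)"
proof (rule has_derivative_of_directional)
  fix b x
  have "(\<lambda>t. iter_dd [] f (x + t *\<^sub>R b)) differentiable (at 0)"
    using assms unfolding smooth_def by blast
  then show "((\<lambda>t. f (x + t *\<^sub>R b)) has_real_derivative iter_dd [b] f x) (at 0)"
    by (simp add: DERIV_deriv_iff_real_differentiable)
next
  show "continuous_on UNIV (iter_dd [b] f)" for b using assms unfolding smooth_def by blast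
qed

lemma smooth_C1: "smooth f \<Longrightarrow> C1 f"
  unfolding C1_def
proof (intro exI conjI allI)
  assume f: "smooth f"
  show "(f has_derivative (\<lambda>h. \<Sum>b\<in>Basis. (h \<bullet> b) * iter_dd [b] f x)) (at x)" for x
    by (rule smooth_has_derivative[OF f])
  have "continuous_on UNIV (iter_dd [b] f)" for b using f unfolding smooth_def by blast
  then show "continuous_on UNIV (\<lambda>x. \<Sum>b\<in>Basis. v \<bullet> b * iter_dd [b] f x)" for v
    by (intro continuous_intros)
qed

lemma iter_dd_append: "iter_dd vs (iter_dd ws f) = iter_dd (vs @ ws) f"
  by (induction vs) auto

lemma smooth_iter_dd: "smooth f \<Longrightarrow> smooth (iter_dd vs f)"
  unfolding smooth_def iter_dd_append by blast

lemma C1_mult: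
  assumes "C1 f" "C1 g"
  shows "C1 (\<lambda>x. f x * g x)"
proof -
  obtain D E where D: "\<And>x. (f has_derivative D x) (at x)" "\<And>v. continuous_on UNIV (\<lambda>x. D x v)"
    and E: "\<And>x. (g has_derivative E x) (at x)" "\<And>v. continuous_on UNIV (\<lambda>x. E x v)"
    using assms unfolding C1_def by blast
  have "continuous_on UNIV f" "continuous_on UNIV g"
    using assms by (auto intro: C1_imp_continuous)
  then show ?thesis
    unfolding C1_def using D E
    by (intro exI[of _ "\<lambda>x h. f x * E x h + D x h * g x"])
       (auto intro!: continuous_intros has_derivative_mult)
qed

lemma C1_sum:
  assumes "\<And>i. i \<in> I \<Longrightarrow> C1 (f i)"
  shows "C1 (\<lambda>x. \<Sum>i\<in>I. f i x)"
proof -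
  have "\<exists>D. \<forall>i\<in>I. (\<forall>x. (f i has_derivative D i x) (at x)) \<and> (\<forall>v. continuous_on UNIV (\<lambda>x. D i x v))"
    using assms unfolding C1_def by (intro bchoice) auto
  then obtain D where "\<forall>i\<in>I. (\<forall>x. (f i has_derivative D i x) (at x)) \<and> (\<forall>v. continuous_on UNIV (\<lambda>x. D i x v))"
    by blast
  then show ?thesis
    unfolding C1_def
    by (intro exI[of _ "\<lambda>x h. \<Sum>i\<in>I. D i x h"]) (auto intro!: continuous_intros has_derivative_sum)
qed

text \<open>Restricts derivatives of the group law to the slice where the second factor is the
  identity; the coefficients of left-invariant fields live there.\<close>

lemma C1_Pair_0:
  assumes "C1 f"
  shows "C1 (\<lambda>x. f (x, 0))"
proof -
  obtain D where D: "\<And>z. (f has_derivative D z) (at z)" "\<And>v. continuous_on UNIV (\<lambda>z. D z v)"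
    using assms unfolding C1_def by blast
  have "((\<lambda>x. f (x, 0)) has_derivative (\<lambda>h. D (x, 0) (h, 0))) (at x)" for x
    by (rule has_derivative_compose[of "\<lambda>x. (x, 0)", OF _ D(1)]) (auto intro!: derivative_eq_intros)
  moreover have "continuous_on UNIV (\<lambda>x. D (x, 0) (v, 0))" for v
    by (rule continuous_on_compose2[OF D(2)]) (auto intro!: continuous_intros)
  ultimately show ?thesis unfolding C1_def by (intro exI[of _ "\<lambda>x h. D (x, 0) (h, 0)"]) auto
qed

text \<open>The only features of the group that matter below: rays from the identity are one-parameter
  subgroups, and the multiplication is smooth.\<close>
locale exp_coords =
  fixes mul :: "'a::euclidean_space \<Rightarrow> 'a \<Rightarrow> 'a"
  assumes one_param: "mul (a *\<^sub>R v) (c *\<^sub>R v) = (a + c) *\<^sub>R v"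
    and smooth_mul: "b \<in> Basis \<Longrightarrow> smooth (\<lambda>z::'a \<times> 'a. mul (fst z) (snd z) \<bullet> b)"
begin

section \<open>Coefficients of left-invariant vector fields\<close>

text \<open>The \<open>b\<close>-coordinate at \<open>x\<close> of the left-invariant field
  generated by \<open>v\<close>. Writing it with \<open>iter_dd\<close> in the direction
  \<open>(0, v)\<close> lets its regularity be read off from smoothness of the
  multiplication.\<close>

definition field_coeff :: "'a \<Rightarrow> 'a \<Rightarrow> 'a \<Rightarrow> real" where
  "field_coeff v b x = iter_dd [(0, v)] (\<lambda>z::'a \<times> 'a. mul (fst z) (snd z) \<bullet> b) (x, 0)"

definition field_vec :: "'a \<Rightarrow> 'a \<Rightarrow> 'a" where
  "field_vec v x = (\<Sum>b\<in>Basis. field_coeff v b x *\<^sub>R b)"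

lemma mul_0_right: "mul x 0 = x"
  using one_param[of 1 x 0] by simp

lemma C1_field_coeff: "b \<in> Basis \<Longrightarrow> C1 (field_coeff v b)"
  unfolding field_coeff_def[abs_def]
  by (intro C1_Pair_0 smooth_C1 smooth_iter_dd smooth_mul)

lemma field_coeff_has_derivative:
  assumes b: "b \<in> Basis"
  shows "((\<lambda>t. mul x (t *\<^sub>R v) \<bullet> b) has_real_derivative field_coeff v b x) (at 0)"
proof -
  let ?m = "\<lambda>z::'a \<times> 'a. mul (fst z) (snd z) \<bullet> b"
  have "(\<lambda>t. iter_dd [] ?m ((x, 0) + t *\<^sub>R (0, v))) differentiable (at 0)"
    using smooth_mul[OF b] unfolding smooth_def by blast
  then show ?thesis
    by (simp add: DERIV_deriv_iff_real_differentiable[symmetric] field_coeff_def)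
qed

text \<open>By the chain rule along the curve \<open>(x, t v)\<close> the coefficient equals
  \<open>D (0, v)\<close>, where \<open>D\<close> is the total derivative of the group law at
  \<open>(x, 0)\<close>, and this is linear in \<open>v\<close>.\<close>

lemma field_coeff_linear:
  assumes b: "b \<in> Basis"
  shows "field_coeff v b x = (\<Sum>c\<in>Basis. (v \<bullet> c) * field_coeff c b x)"
proof -
  let ?m = "\<lambda>z::'a \<times> 'a. mul (fst z) (snd z) \<bullet> b"
  obtain D where D: "(?m has_derivative D) (at (x, 0))"
    using smooth_has_derivative[OF smooth_mul[OF b]] by blast
  have eq: "field_coeff v b x = D (0, v)" for v
  proof -
    have "((\<lambda>t. (x, t *\<^sub>R v)) has_derivative (\<lambda>t. (0, t *\<^sub>R v))) (at 0)"
      by (auto intro!: derivative_eq_intros)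
    moreover have "(?m has_derivative D) (at (x, 0 *\<^sub>R v))" using D by simp
    ultimately have "((\<lambda>t. mul x (t *\<^sub>R v) \<bullet> b) has_derivative (\<lambda>t. D (0, t *\<^sub>R v))) (at 0)"
      using has_derivative_compose[of "\<lambda>t. (x, t *\<^sub>R v)" _ 0 UNIV ?m D] by simp
    moreover have "(\<lambda>t. D (0, t *\<^sub>R v)) = (*) (D (0, v))"
    proof
      fix t
      have "D (t *\<^sub>R (0, v)) = t *\<^sub>R D (0, v)"
        using has_derivative_linear[OF D] by (rule linear_scale)
      then show "D (0, t *\<^sub>R v) = D (0, v) * t" by simp
    qed
    ultimately have "((\<lambda>t. mul x (t *\<^sub>R v) \<bullet> b) has_real_derivative D (0, v)) (at 0)"
      by (simp add: has_field_derivative_def)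
    then show ?thesis using field_coeff_has_derivative[OF b] DERIV_unique by blast
  qed
  have lin: "linear (\<lambda>v. D (0, v))"
    using linear_compose[OF _ has_derivative_linear[OF D], of "\<lambda>v. (0, v)"]
    by (simp add: o_def linear_iff)
  have "D (0, v) = D (0, \<Sum>c\<in>Basis. (v \<bullet> c) *\<^sub>R c)" by (simp add: euclidean_representation)
  also have "\<dots> = (\<Sum>c\<in>Basis. (v \<bullet> c) * D (0, c))"
    using linear_sum[OF lin, of "\<lambda>c. (v \<bullet> c) *\<^sub>R c" Basis] linear_scale[OF lin] by simp
  finally show ?thesis by (simp add: eq)
qed

lemma field_vec_linear: "field_vec v x = (\<Sum>c\<in>Basis. (v \<bullet> c) *\<^sub>R field_vec c x)"
proof (rule euclidean_eqI)
  fix b :: 'a assume b: "b \<in> Basis"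
  have e: "field_vec v x \<bullet> b = field_coeff v b x" for v
    unfolding field_vec_def using b by (simp add: inner_sum_left inner_Basis if_distrib[of "\<lambda>y. _ * y"] sum.delta cong: if_cong)
  show "field_vec v x \<bullet> b = (\<Sum>c\<in>Basis. (v \<bullet> c) *\<^sub>R field_vec c x) \<bullet> b"
    by (simp add: inner_sum_left e field_coeff_linear[OF b, of v])
qed

text \<open>The curve \<open>mul x (t v)\<close> starts at \<open>x\<close> with velocity
  \<open>field_vec v x\<close>, so the chain rule applies.\<close>

lemma lvf_has_derivative:
  assumes "(\<psi> has_derivative D) (at x)"
  shows "((\<lambda>t. \<psi> (mul x (t *\<^sub>R v))) has_real_derivative D (field_vec v x)) (at 0)"
proof -
  have "((\<lambda>t. \<Sum>b\<in>Basis. (mul x (t *\<^sub>R v) \<bullet> b) *\<^sub>R b) has_vector_derivative field_vec v x) (at 0)"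
    unfolding field_vec_def
  proof (rule has_vector_derivative_sum)
    fix b :: 'a assume "b \<in> Basis"
    from field_coeff_has_derivative[OF this]
    have "((\<lambda>t. mul x (t *\<^sub>R v) \<bullet> b) has_vector_derivative field_coeff v b x) (at 0)"
      by (simp add: has_real_derivative_iff_has_vector_derivative)
    from bounded_linear.has_vector_derivative[OF bounded_linear_scaleR_left this]
    show "((\<lambda>t. (mul x (t *\<^sub>R v) \<bullet> b) *\<^sub>R b) has_vector_derivative field_coeff v b x *\<^sub>R b) (at 0)" .
  qed
  then have "((\<lambda>t. mul x (t *\<^sub>R v)) has_derivative (\<lambda>t. t *\<^sub>R field_vec v x)) (at 0)"
    by (simp add: euclidean_representation has_vector_derivative_def)
  moreover have "(\<psi> has_derivative D) (at (mul x (0 *\<^sub>R v)))" using assms by (simp add: mul_0_right)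
  ultimately have "((\<lambda>t. \<psi> (mul x (t *\<^sub>R v))) has_derivative (\<lambda>t. D (t *\<^sub>R field_vec v x))) (at 0)"
    by (rule has_derivative_compose)
  moreover have "(\<lambda>t. D (t *\<^sub>R field_vec v x)) = (*) (D (field_vec v x))"
    by (rule ext) (simp add: linear_scale[OF has_derivative_linear[OF assms]])
  ultimately show ?thesis by (simp add: has_field_derivative_def)
qed

lemma lvf_eq:
  assumes "(\<psi> has_derivative D) (at x)"
  shows "lvf mul v \<psi> x = D (field_vec v x)"
  unfolding lvf_def using lvf_has_derivative[OF assms] by (rule DERIV_imp_deriv)

lemma lvf_eq_sum:
  assumes "(\<psi> has_derivative D) (at x)"
  shows "lvf mul v \<psi> x = (\<Sum>b\<in>Basis. field_coeff v b x * D b)"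
proof -
  have "D (\<Sum>b\<in>Basis. field_coeff v b x *\<^sub>R b) = (\<Sum>b\<in>Basis. field_coeff v b x * D b)"
    using linear_sum[OF has_derivative_linear[OF assms], of "\<lambda>b. field_coeff v b x *\<^sub>R b" Basis]
      linear_scale[OF has_derivative_linear[OF assms]] by simp
  then show ?thesis by (simp add: lvf_eq[OF assms] field_vec_def)
qed

text \<open>Since \<open>mul (t x) (h x) = (t + h) x\<close>, the ray through \<open>x\<close> is an
  integral curve of the left-invariant field generated by \<open>x\<close>. By linearity that field
  is the combination of the \<open>X^b\<close> with the constant coefficients
  \<open>x \<bullet> b\<close>.\<close>

lemma ray_has_derivative:
  assumes "C1 \<psi>"
  shows "((\<lambda>t. \<psi> (t *\<^sub>R x)) has_real_derivative (\<Sum>b\<in>Basis. (x \<bullet> b) * lvf mul b \<psi> (t *\<^sub>R x))) (at t)"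
proof -
  obtain D where D: "(\<psi> has_derivative D) (at (t *\<^sub>R x))"
    using assms unfolding C1_def by blast
  have "D (field_vec x (t *\<^sub>R x)) = D (\<Sum>c\<in>Basis. (x \<bullet> c) *\<^sub>R field_vec c (t *\<^sub>R x))"
    using field_vec_linear[of x "t *\<^sub>R x"] by simp
  also have "\<dots> = (\<Sum>b\<in>Basis. (x \<bullet> b) * lvf mul b \<psi> (t *\<^sub>R x))"
    using linear_sum[OF has_derivative_linear[OF D], of "\<lambda>b. (x \<bullet> b) *\<^sub>R field_vec b (t *\<^sub>R x)" Basis]
      linear_scale[OF has_derivative_linear[OF D]] by (simp add: lvf_eq[OF D])
  finally have "((\<lambda>h. \<psi> ((h + t) *\<^sub>R x)) has_real_derivative (\<Sum>b\<in>Basis. (x \<bullet> b) * lvf mul b \<psi> (t *\<^sub>R x))) (at 0)"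
    using lvf_has_derivative[OF D, of x] by (simp add: one_param add.commute)
  then show ?thesis
    using DERIV_shift[of "\<lambda>t. \<psi> (t *\<^sub>R x)" _ 0 t] by simp
qed

text \<open>In coordinates the field is a first-order operator with \<open>C1\<close> coefficients,
  applied to a smooth function.\<close>

lemma C1_lvf:
  assumes "smooth \<phi>"
  shows "C1 (lvf mul v \<phi>)"
proof -
  have "lvf mul v \<phi> = (\<lambda>x. \<Sum>b\<in>Basis. field_coeff v b x * iter_dd [b] \<phi> x)"
  proof
    fix x
    have "(\<Sum>c\<in>Basis. (b \<bullet> c) * iter_dd [c] \<phi> x) = iter_dd [b] \<phi> x" if "b \<in> Basis" for b
      using that by (simp add: inner_Basis if_distrib[of "\<lambda>y. y * _"] sum.delta cong: if_cong)
    then show "lvf mul v \<phi> x = (\<Sum>b\<in>Basis. field_coeff v b x * iter_dd [b] \<phi> x)"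
      using lvf_eq_sum[OF smooth_has_derivative[OF assms]] by simp
  qed
  moreover have "C1 (\<lambda>x. \<Sum>b\<in>Basis. field_coeff v b x * iter_dd [b] \<phi> x)"
    by (intro C1_sum C1_mult C1_field_coeff smooth_C1[OF smooth_iter_dd[OF assms]])
  ultimately show ?thesis by simp
qed

lemma continuous_lvf:
  assumes "C1 \<psi>"
  shows "continuous_on UNIV (lvf mul v \<psi>)"
proof -
  obtain D where D: "\<And>x. (\<psi> has_derivative D x) (at x)" "\<And>v. continuous_on UNIV (\<lambda>x. D x v)"
    using assms unfolding C1_def by blast
  have "lvf mul v \<psi> = (\<lambda>x. \<Sum>b\<in>Basis. field_coeff v b x * D x b)"
    by (intro ext lvf_eq_sum D(1))
  then show ?thesis
    using D(2) by (auto intro!: continuous_on_sum continuous_on_mult C1_imp_continuous[OF C1_field_coeff])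
qed

text \<open>The derivative depends only on values near \<open>x\<close>, and the exterior of a
  closed ball is open. Hence one radius \<open>R\<close> serves a test function and its first and
  second derivatives along the fields.\<close>

lemma lvf_eq_0_outside:
  assumes "C1 \<psi>" "\<And>x. R < norm x \<Longrightarrow> \<psi> x = 0" "R < norm x"
  shows "lvf mul v \<psi> x = 0"
proof -
  obtain D where D: "(\<psi> has_derivative D) (at x)"
    using assms unfolding C1_def by blast
  have "open {x::'a. R < norm x}" by (intro open_Collect_less continuous_intros)
  then have "((\<lambda>_. 0) has_derivative D) (at x)"
    by (rule has_derivative_transform_within_open[OF D]) (use assms in auto)
  then have "D = (\<lambda>_. 0)"
    by (rule has_derivative_unique) (rule has_derivative_const)
  then show ?thesis by (simp add: lvf_eq[OF D])
qed

end

lemma bounded_of_compact_support: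
  fixes \<psi> :: "'a::euclidean_space \<Rightarrow> real"
  assumes "continuous_on UNIV \<psi>" "\<And>x. R < norm x \<Longrightarrow> \<psi> x = 0"
  obtains B where "\<And>x. \<bar>\<psi> x\<bar> \<le> B"
proof -
  have "compact (\<psi> ` cball 0 R)"
    using assms(1) by (intro compact_continuous_image) (auto intro: continuous_on_subset)
  then have "bounded (\<psi> ` cball 0 R)" by (rule compact_imp_bounded)
  then obtain B where "0 < B" "\<forall>y\<in>\<psi> ` cball 0 R. norm y \<le> B"
    unfolding bounded_pos by blast
  then have B: "0 < B" "\<And>x. x \<in> cball 0 R \<Longrightarrow> \<bar>\<psi> x\<bar> \<le> B"
    by auto
  have "\<bar>\<psi> x\<bar> \<le> B" for x
    using B assms(2)[of x] by (cases "R < norm x") auto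
  then show ?thesis by (rule that)
qed

section \<open>Taylor formulas along rays\<close>

lemma integrable_indicator_open_interval:
  fixes f :: "real \<Rightarrow> real"
  assumes f: "continuous_on UNIV f"
  shows "integrable lborel (\<lambda>t. indicator {a<..<b} t * f t)"
proof -
  have "integrable lborel (\<lambda>t. indicator {a..b} t *\<^sub>R f t)"
    using f by (intro borel_integrable_compact) (auto intro: continuous_on_subset)
  moreover have "f \<in> borel_measurable borel" using f by (rule borel_measurable_continuous_onI)
  ultimately show ?thesis
    by (rule_tac Bochner_Integration.integrable_bound) (auto split: split_indicator)
qed

text \<open>The kernels are cut off by indicators of open intervals; the endpoints are null, so the
  fundamental theorem on the closed interval carries over.\<close>

lemma integral_FTC_open_interval:
  fixes f F :: "real \<Rightarrow> real"
  assumes "a \<le> b" "\<And>t. (F has_real_derivative f t) (at t)" and f: "continuous_on UNIV f"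
  shows "(\<integral>t. indicator {a<..<b} t * f t \<partial>lborel) = F b - F a"
proof -
  have [measurable]: "f \<in> borel_measurable borel" using f by (rule borel_measurable_continuous_onI)
  have "(\<integral>t. f t * indicator {a..b} t \<partial>lborel) = F b - F a"
    using assms by (intro integral_FTC_Icc_real) (auto simp: continuous_on_eq_continuous_at)
  moreover have "(\<integral>t. indicator {a<..<b} t * f t \<partial>lborel) = (\<integral>t. f t * indicator {a..b} t \<partial>lborel)"
    using AE_lborel_singleton[of a] AE_lborel_singleton[of b]
    by (intro integral_cong_AE) (measurable, auto split: split_indicator)
  ultimately show ?thesis by simp
qed

lemma continuous_on_ray:
  fixes \<psi> :: "'a::real_normed_vector \<Rightarrow> real"
  shows "continuous_on UNIV \<psi> \<Longrightarrow> continuous_on UNIV (\<lambda>t::real. \<psi> (t *\<^sub>R x))"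
  by (rule continuous_on_compose2[of UNIV \<psi>]) (auto intro!: continuous_intros)

context exp_coords
begin

section \<open>Expansions from the identity and from infinity\<close>

lemma ray_Taylor_1:
  assumes \<psi>: "C1 \<psi>"
  shows "\<psi> x = \<psi> 0 + (\<Sum>b\<in>Basis. (x \<bullet> b) *
    (\<integral>t. indicator {0<..<1} t * lvf mul b \<psi> (t *\<^sub>R x) \<partial>lborel))"
proof -
  note c = continuous_on_ray[OF continuous_lvf[OF \<psi>]]
  have "(\<Sum>b\<in>Basis. (x \<bullet> b) * (\<integral>t. indicator {0<..<1} t * lvf mul b \<psi> (t *\<^sub>R x) \<partial>lborel))
      = (\<integral>t. (\<Sum>b\<in>Basis. (x \<bullet> b) * (indicator {0<..<1} t * lvf mul b \<psi> (t *\<^sub>R x))) \<partial>lborel)"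
    by (simp add: Bochner_Integration.integral_sum integrable_indicator_open_interval c)
  also have "\<dots> = (\<integral>t. indicator {0<..<1} t * (\<Sum>b\<in>Basis. (x \<bullet> b) * lvf mul b \<psi> (t *\<^sub>R x)) \<partial>lborel)"
    by (simp add: sum_distrib_left mult.left_commute)
  also have "\<dots> = \<psi> (1 *\<^sub>R x) - \<psi> (0 *\<^sub>R x)"
    by (intro integral_FTC_open_interval ray_has_derivative[OF \<psi>] continuous_intros c) auto
  finally show ?thesis by simp
qed

text \<open>Integration by parts with the weight \<open>1 - t\<close>, which vanishes at 1 and
  leaves only the boundary term at the identity. Applied to \<open>X^b \<phi>\<close>, it turns a
  first-order remainder into a second-order one.\<close>

lemma ray_Taylor_remainder:
  assumes \<psi>: "C1 \<psi>"
  shows "(\<integral>t. indicator {0<..<1} t * \<psi> (t *\<^sub>R x) \<partial>lborel) = \<psi> 0 + (\<Sum>c\<in>Basis. (x \<bullet> c) *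
    (\<integral>t. indicator {0<..<1} t * (1 - t) * lvf mul c \<psi> (t *\<^sub>R x) \<partial>lborel))"
proof -
  note c = continuous_on_ray[OF continuous_lvf[OF \<psi>]] and c0 = continuous_on_ray[OF C1_imp_continuous[OF \<psi>]]
  have i: "integrable lborel (\<lambda>t. indicator {0<..<1} t * ((1 - t) * lvf mul c \<psi> (t *\<^sub>R x)))" for c
    by (intro integrable_indicator_open_interval continuous_intros c)
  have "(\<Sum>c\<in>Basis. (x \<bullet> c) * (\<integral>t. indicator {0<..<1} t * (1 - t) * lvf mul c \<psi> (t *\<^sub>R x) \<partial>lborel))
      = (\<integral>t. (\<Sum>c\<in>Basis. (x \<bullet> c) * (indicator {0<..<1} t * ((1 - t) * lvf mul c \<psi> (t *\<^sub>R x)))) \<partial>lborel)"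
    using i by (simp add: Bochner_Integration.integral_sum mult.assoc)
  \<comment> \<open>Adding and subtracting \<open>\<psi> (t x)\<close> completes the derivative of
    \<open>(1 - t) \<psi> (t x)\<close>.\<close>
  also have "\<dots> = (\<integral>t. indicator {0<..<1} t * ((1 - t) * (\<Sum>c\<in>Basis. (x \<bullet> c) * lvf mul c \<psi> (t *\<^sub>R x)) - \<psi> (t *\<^sub>R x))
       + indicator {0<..<1} t * \<psi> (t *\<^sub>R x) \<partial>lborel)"
    by (intro Bochner_Integration.integral_cong) (auto simp: sum_distrib_left algebra_simps)
  also have "\<dots> = (\<integral>t. indicator {0<..<1} t * ((1 - t) * (\<Sum>c\<in>Basis. (x \<bullet> c) * lvf mul c \<psi> (t *\<^sub>R x)) - \<psi> (t *\<^sub>R x)) \<partial>lborel)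
       + (\<integral>t. indicator {0<..<1} t * \<psi> (t *\<^sub>R x) \<partial>lborel)"
    by (intro Bochner_Integration.integral_add integrable_indicator_open_interval continuous_intros c c0)
  also have "(\<integral>t. indicator {0<..<1} t * ((1 - t) * (\<Sum>c\<in>Basis. (x \<bullet> c) * lvf mul c \<psi> (t *\<^sub>R x)) - \<psi> (t *\<^sub>R x)) \<partial>lborel)
      = (1 - 1) * \<psi> (1 *\<^sub>R x) - (1 - 0) * \<psi> (0 *\<^sub>R x)"
  proof (rule integral_FTC_open_interval[where F = "\<lambda>t. (1 - t) * \<psi> (t *\<^sub>R x)"])
    show "((\<lambda>t. (1 - t) * \<psi> (t *\<^sub>R x)) has_real_derivative
        (1 - t) * (\<Sum>c\<in>Basis. (x \<bullet> c) * lvf mul c \<psi> (t *\<^sub>R x)) - \<psi> (t *\<^sub>R x)) (at t)" for t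
      by (rule DERIV_cong[OF DERIV_mult[OF _ ray_has_derivative[OF \<psi>]]])
         (auto intro!: derivative_eq_intros)
  qed (auto intro!: continuous_intros c c0)
  finally show ?thesis by simp
qed

text \<open>For \<open>\<theta> t = \<phi> (t x)\<close> the function
  \<open>(t - 1) \<theta>' - \<theta>\<close> is an antiderivative of
  \<open>(t - 1) \<theta>''\<close>. It equals \<open>- \<phi> x\<close> at \<open>t = 1\<close> and
  vanishes once the ray has left the support, which happens because \<open>x\<close> is
  nonzero.\<close>

lemma ray_Taylor_infinity:
  assumes \<phi>: "smooth \<phi>" and R: "\<And>x. R < norm x \<Longrightarrow> \<phi> x = 0" and x: "x \<noteq> 0"
  shows "\<phi> x = (\<Sum>b\<in>Basis. \<Sum>c\<in>Basis. (x \<bullet> b) * (x \<bullet> c) *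
    (\<integral>t. indicator {1<..} t * (t - 1) * lvf mul c (lvf mul b \<phi>) (t *\<^sub>R x) \<partial>lborel))"
proof -
  \<comment> \<open>From \<open>L\<close> on, the ray lies outside the ball of radius
    \<open>R\<close>; the numerator \<open>|R| + 1\<close> ensures strict inequality and covers
    negative \<open>R\<close>.\<close>
  define L where "L = max 1 ((\<bar>R\<bar> + 1) / norm x)"
  have LR: "R < norm (t *\<^sub>R x)" if "L \<le> t" for t
  proof -
    have "R < (\<bar>R\<bar> + 1) / norm x * norm x" using x by simp
    also have "\<dots> \<le> L * norm x" by (intro mult_right_mono) (auto simp: L_def)
    also have "\<dots> \<le> t * norm x" using that by (intro mult_right_mono) auto
    also have "\<dots> \<le> norm (t *\<^sub>R x)" by (simp add: mult_right_mono)
    finally show ?thesis .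
  qed
  have L1: "1 \<le> L" by (simp add: L_def)
  have C: "C1 \<phi>" "\<And>b. C1 (lvf mul b \<phi>)" using \<phi> by (auto intro: smooth_C1 C1_lvf)
  have s1: "lvf mul b \<phi> y = 0" if "R < norm y" for b y
    by (rule lvf_eq_0_outside[OF C(1) R that])
  have s2: "lvf mul c (lvf mul b \<phi>) y = 0" if "R < norm y" for b c y
    by (rule lvf_eq_0_outside[OF C(2) s1 that])
  note c = continuous_on_ray[OF continuous_lvf[OF C(2)]]
  define \<theta>1 where "\<theta>1 t = (\<Sum>b\<in>Basis. (x \<bullet> b) * lvf mul b \<phi> (t *\<^sub>R x))" for t
  define \<theta>2 where "\<theta>2 t = (\<Sum>b\<in>Basis. (x \<bullet> b) * (\<Sum>c\<in>Basis. (x \<bullet> c) * lvf mul c (lvf mul b \<phi>) (t *\<^sub>R x)))" for t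
  have d1: "((\<lambda>t. \<phi> (t *\<^sub>R x)) has_real_derivative \<theta>1 t) (at t)" for t
    unfolding \<theta>1_def by (rule ray_has_derivative[OF C(1)])
  have d2: "(\<theta>1 has_real_derivative \<theta>2 t) (at t)" for t
    unfolding \<theta>1_def[abs_def] \<theta>2_def by (intro DERIV_sum DERIV_cmult ray_has_derivative[OF C(2)])
  have cut: "indicator {1<..} t * (t - 1) * lvf mul c (lvf mul b \<phi>) (t *\<^sub>R x)
      = indicator {1<..<L} t * ((t - 1) * lvf mul c (lvf mul b \<phi>) (t *\<^sub>R x))" for b c t
    using s2[OF LR, of t] by (auto split: split_indicator)
  have i: "integrable lborel (\<lambda>t. indicator {1<..<L} t * ((t - 1) * lvf mul c (lvf mul b \<phi>) (t *\<^sub>R x)))" for b c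
    by (intro integrable_indicator_open_interval continuous_intros c)
  have "(\<Sum>b\<in>Basis. \<Sum>c\<in>Basis. (x \<bullet> b) * (x \<bullet> c) *
      (\<integral>t. indicator {1<..} t * (t - 1) * lvf mul c (lvf mul b \<phi>) (t *\<^sub>R x) \<partial>lborel))
     = (\<integral>t. (\<Sum>b\<in>Basis. \<Sum>c\<in>Basis. (x \<bullet> b) * (x \<bullet> c) *
         (indicator {1<..<L} t * ((t - 1) * lvf mul c (lvf mul b \<phi>) (t *\<^sub>R x)))) \<partial>lborel)"
    unfolding cut using i by (simp add: Bochner_Integration.integral_sum)
  also have "\<dots> = (\<integral>t. indicator {1<..<L} t * ((t - 1) * \<theta>2 t) \<partial>lborel)"
    unfolding \<theta>2_def by (simp add: sum_distrib_left ac_simps)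
  also have "\<dots> = ((L - 1) * \<theta>1 L - \<phi> (L *\<^sub>R x)) - ((1 - 1) * \<theta>1 1 - \<phi> (1 *\<^sub>R x))"
  proof (rule integral_FTC_open_interval[where F = "\<lambda>t. (t - 1) * \<theta>1 t - \<phi> (t *\<^sub>R x)", OF L1])
    show "((\<lambda>t. (t - 1) * \<theta>1 t - \<phi> (t *\<^sub>R x)) has_real_derivative (t - 1) * \<theta>2 t) (at t)" for t
      by (rule DERIV_cong[OF DERIV_diff[OF DERIV_mult[OF _ d2] d1]])
         (auto intro!: derivative_eq_intros)
    show "continuous_on UNIV (\<lambda>t. (t - 1) * \<theta>2 t)"
      unfolding \<theta>2_def by (intro continuous_intros c)
  qed
  also have "\<dots> = \<phi> x"
    using R[OF LR, of L] s1[OF LR, of L] by (simp add: \<theta>1_def)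
  finally show ?thesis by simp
qed

end

section \<open>The decomposition\<close>

lemma carnot_group_exp_coords: "carnot_group mul br w s \<Longrightarrow> exp_coords mul"
  unfolding carnot_group_def exp_coords_def by auto

lemma DIM_le_hom_dim:
  assumes "carnot_group mul br w s"
  shows "DIM('a::euclidean_space) \<le> hom_dim (w :: 'a \<Rightarrow> nat)"
proof -
  have "(\<Sum>b\<in>(Basis::'a set). 1) \<le> hom_dim w"
    unfolding hom_dim_def using assms by (intro sum_mono) (auto simp: carnot_group_def)
  then show ?thesis by simp
qed

lemma hom_dim_le:
  assumes "carnot_group mul br w s"
  shows "hom_dim (w :: 'a::euclidean_space \<Rightarrow> nat) \<le> s * DIM('a)"
proof -
  have "hom_dim w \<le> (\<Sum>b\<in>(Basis::'a set). s)"
    unfolding hom_dim_def using assms by (intro sum_mono) (auto simp: carnot_group_def)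
  then show ?thesis by (simp add: mult.commute)
qed

text \<open>The exponent conditions, stated with \<open>Q\<close>, imply the ones for Euclidean dilations,
  where \<open>Q\<close> is replaced by the topological dimension.\<close>
lemma dil_exp_subcritical:
  assumes G: "carnot_group mul br (w :: 'a::euclidean_space \<Rightarrow> nat) s" and p: "1 \<le> p" "p \<noteq> \<infinity>"
    and le: "real_of_ereal p * (real (hom_dim w) - 1) < real (hom_dim w)"
  shows "real DIM('a) - 1 < dil_exp TYPE('a) p"
proof -
  define P where "P = real_of_ereal p"
  have P: "1 \<le> P" unfolding P_def using p by (cases p) (auto simp: one_ereal_def)
  \<comment> \<open>The hypothesis reads \<open>(P - 1) * Q < P\<close>, which is inherited by any
    dimension not exceeding \<open>Q\<close>.\<close>
  have "(P - 1) * real DIM('a) \<le> (P - 1) * real (hom_dim w)"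
    using DIM_le_hom_dim[OF G] P by (intro mult_left_mono) auto
  also have "\<dots> < P" using le by (simp add: P_def algebra_simps)
  finally have "(real DIM('a) - 1) * P < real DIM('a)" by (simp add: algebra_simps)
  then show ?thesis unfolding dil_exp_def P_def[symmetric] using P by (simp add: pos_less_divide_eq)
qed

text \<open>Rewritten as \<open>2 s P < (P - 1) Q\<close> and combined with
  \<open>Q \<le> s * DIM\<close>, the condition loses its factor \<open>s\<close> and becomes
  \<open>2 P < (P - 1) DIM\<close>. For infinite \<open>p\<close>, where \<open>dil_exp\<close> is
  0, the bound \<open>2 s < Q \<le> s * DIM\<close> gives dimension above 2.\<close>

lemma dil_exp_supercritical:
  assumes G: "carnot_group mul br (w :: 'a::euclidean_space \<Rightarrow> nat) s" and p: "1 \<le> p"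
    and Q: "2 * s < hom_dim w"
    and le: "p = \<infinity> \<or> real_of_ereal p * (real (hom_dim w) - 2 * real s) > real (hom_dim w)"
  shows "dil_exp TYPE('a) p < real DIM('a) - 2"
proof (cases "p = \<infinity>")
  case True
  have "2 * s < s * DIM('a)" using Q hom_dim_le[OF G] by linarith
  then have "2 < DIM('a)" by (simp add: mult.commute[of 2])
  then show ?thesis using True by (simp add: dil_exp_def)
next
  case False
  define P where "P = real_of_ereal p"
  have P: "1 \<le> P" unfolding P_def using p False by (cases p) (auto simp: one_ereal_def)
  have s: "0 < real s" using G by (simp add: carnot_group_def)
  have "real s * (2 * P) < (P - 1) * real (hom_dim w)"
    using le False by (simp add: P_def algebra_simps)
  also have "\<dots> \<le> (P - 1) * real (s * DIM('a))"
    using P hom_dim_le[OF G] by (intro mult_left_mono) linarith+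
  also have "\<dots> = real s * ((P - 1) * real DIM('a))" by simp
  finally have "2 * P < (P - 1) * real DIM('a)" using s by (simp only: mult_less_cancel_left_pos)
  then have "real DIM('a) < (real DIM('a) - 2) * P" by (simp add: algebra_simps)
  then show ?thesis unfolding dil_exp_def P_def[symmetric] using P by (simp add: pos_divide_less_eq)
qed

section \<open>Recovering \<open>f\<close> and its moments from the weighted functions\<close>

text \<open>Dividing by \<open>|x|^2\<close> recovers \<open>f\<close> away from the origin, and
  changing a function at one point preserves measurability.\<close>

lemma borel_measurable_lebesgue_off_0:
  fixes f :: "'a::euclidean_space \<Rightarrow> real"
  assumes "(\<lambda>x. (norm x)\<^sup>2 * f x) \<in> borel_measurable lebesgue"
  shows "f \<in> borel_measurable lebesgue"
proof -
  have [measurable]: "(\<lambda>x::'a. norm x) \<in> borel_measurable lebesgue" "{0::'a} \<in> sets lebesgue"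
    by (auto intro: measurable_completion)
  note [measurable] = assms
  have "(\<lambda>x. if x \<in> {0} then f 0 else (norm x)\<^sup>2 * f x / (norm x)\<^sup>2) \<in> borel_measurable lebesgue"
    by measurable
  also have "(\<lambda>x. if x \<in> {0} then f 0 else (norm x)\<^sup>2 * f x / (norm x)\<^sup>2) = f" by auto
  finally show ?thesis .
qed

text \<open>A Borel stand-in for \<open>x\<^sub>b x\<^sub>c f(x)\<close>, where \<open>G = |x|\<^sup>2 f\<close> almost everywhere.\<close>
definition quad_part :: "('a::euclidean_space \<Rightarrow> real) \<Rightarrow> 'a \<Rightarrow> 'a \<Rightarrow> 'a \<Rightarrow> real" where
  "quad_part G b c x = (x \<bullet> b) * (x \<bullet> c) / (norm x)\<^sup>2 * G x"

text \<open>A Borel stand-in for \<open>x_b f(x)\<close> when \<open>G = |x| f\<close> almost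
  everywhere; at the origin division by zero makes it 0.\<close>

definition lin_part :: "('a::euclidean_space \<Rightarrow> real) \<Rightarrow> 'a \<Rightarrow> 'a \<Rightarrow> real" where
  "lin_part G b x = (x \<bullet> b) / norm x * G x"

lemma Lp_bdd_quad_part:
  assumes G: "Lp_bdd p G A" and p: "1 \<le> p" and bc: "b \<in> Basis" "c \<in> Basis"
  shows "Lp_bdd p (quad_part G b c) A"
proof (rule Lp_bdd_mono[OF G p])
  have [measurable]: "G \<in> borel_measurable borel" using G by (simp add: Lp_bdd_def)
  show "quad_part G b c \<in> borel_measurable borel" unfolding quad_part_def[abs_def] by measurable
  fix x
  have "\<bar>x \<bullet> b\<bar> * \<bar>x \<bullet> c\<bar> \<le> norm x * norm x"
    using bc by (intro mult_mono Basis_le_norm) auto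
  then have "\<bar>(x \<bullet> b) * (x \<bullet> c) / (norm x)\<^sup>2\<bar> \<le> 1"
    by (auto simp: abs_mult power2_eq_square divide_le_eq_1)
  then show "\<bar>quad_part G b c x\<bar> \<le> \<bar>G x\<bar>"
    unfolding quad_part_def by (simp only: abs_mult[of _ "G x"]) (rule mult_left_le_one_le, auto)
qed simp

lemma Lp_bdd_lin_part:
  assumes G: "Lp_bdd p G A" and p: "1 \<le> p" and b: "b \<in> Basis"
  shows "Lp_bdd p (lin_part G b) A"
proof (rule Lp_bdd_mono[OF G p])
  have [measurable]: "G \<in> borel_measurable borel" using G by (simp add: Lp_bdd_def)
  show "lin_part G b \<in> borel_measurable borel" unfolding lin_part_def[abs_def] by measurable
  fix x
  have "\<bar>(x \<bullet> b) / norm x\<bar> \<le> 1" using Basis_le_norm[OF b, of x] by (auto simp: divide_le_eq_1)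
  then show "\<bar>lin_part G b x\<bar> \<le> \<bar>G x\<bar>"
    unfolding lin_part_def by (simp only: abs_mult[of _ "G x"]) (rule mult_left_le_one_le, auto)
qed simp

lemma Lp_bdd_zero: "1 \<le> p \<Longrightarrow> 0 \<le> A \<Longrightarrow> Lp_bdd p (\<lambda>x. 0) A"
  by (simp add: Lp_bdd_def)

lemma Lp_bdd_uminus: "Lp_bdd p g A \<Longrightarrow> Lp_bdd p (\<lambda>x. - g x) A"
  by (auto simp: Lp_bdd_def)

text \<open>The distributional identity integrates against Lebesgue measure; as all functions here
  are Borel, the duality passes to the completion. Continuity and compact support supply the bound
  on the test function.\<close>

lemma dil_avg_pairing_lebesgue:
  fixes g \<psi> :: "'a::euclidean_space \<Rightarrow> real"
  assumes g: "Lp_bdd p g A" and k: "kernel TYPE('a) p u C" and p: "1 \<le> p"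
    and \<psi>: "continuous_on UNIV \<psi>" and R: "\<And>x. R < norm x \<Longrightarrow> \<psi> x = 0"
  shows "integrable lebesgue (\<lambda>x. g x * (\<integral>t. u t * \<psi> (t *\<^sub>R x) \<partial>lborel))" (is ?I)
    and "(\<integral>x. dil_avg u g x * \<psi> x \<partial>lebesgue)
      = (\<integral>x. g x * (\<integral>t. u t * \<psi> (t *\<^sub>R x) \<partial>lborel) \<partial>lebesgue)" (is ?E)
proof -
  obtain B where B: "\<And>x. \<bar>\<psi> x\<bar> \<le> B" using bounded_of_compact_support[OF \<psi> R] by blast
  have [measurable]: "\<psi> \<in> borel_measurable borel" using \<psi> by (rule borel_measurable_continuous_onI)
  have [measurable]: "u \<in> borel_measurable borel" "g \<in> borel_measurable borel"
    using g k by (auto simp: kernel_def Lp_bdd_def)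
  have [measurable]: "dil_avg u g \<in> borel_measurable borel" by (intro borel_measurable_dil_avg) auto
  note * = dil_avg_pairing[where \<psi> = \<psi> and B = B and R = R, OF g k p _ B R]
  show ?I using *(1) by (subst integrable_completion) auto
  show ?E using *(2) by (subst (1 2) integral_completion) auto
qed

section \<open>The decompositions in the two ranges of exponents\<close>

text \<open>Taylor's formula from the identity is integrated against \<open>f\<close>, and duality
  moves the averaging along rays onto \<open>x_b x_c f\<close> and \<open>x_b f\<close>. The terms
  at the identity become the multiples of the Dirac mass and its derivatives.\<close>

lemma decomposition_subcritical:
  fixes mul :: "'a::euclidean_space \<Rightarrow> 'a \<Rightarrow> 'a" and f :: "'a \<Rightarrow> real"
  assumes "exp_coords mul" and p1: "1 \<le> p"
    and k0: "kernel TYPE('a) p (indicator {0<..<1}) C"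
    and k1: "kernel TYPE('a) p (\<lambda>t. indicator {0<..<1} t * (1 - t)) C"
    and fin: "(\<integral>\<^sup>+ x. ennreal (\<bar>f x\<bar> * (1 + norm x)) \<partial>lebesgue) < \<infinity>"
    and m1: "memLp p (\<lambda>x. norm x * f x)" and m2: "memLp p (\<lambda>x. (norm x)\<^sup>2 * f x)"
  shows "\<exists>F F1.
            (\<forall>b\<in>Basis. \<forall>c\<in>Basis. memLp p (F b c) \<and>
                 Lp_norm p (F b c) \<le> C * Lp_norm p (\<lambda>x. (norm x)\<^sup>2 * f x)) \<and>
            (\<forall>b\<in>Basis. w b \<noteq> 1 \<longrightarrow> memLp p (F1 b) \<and>
                 Lp_norm p (F1 b) \<le> C * Lp_norm p (\<lambda>x. norm x * f x)) \<and>
            distr_identity mul w f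
              (\<integral>x. f x \<partial>lebesgue) (\<lambda>b. \<integral>x. f x * (x \<bullet> b) \<partial>lebesgue) F F1"
proof -
  interpret exp_coords mul by fact
  let ?u0 = "indicator {0<..<1} :: real \<Rightarrow> real" and ?u1 = "\<lambda>t::real. indicator {0<..<1} t * (1 - t) :: real"
  obtain G1 where G1: "Lp_bdd p G1 (Lp_norm p (\<lambda>x. norm x * f x))"
    and ae1: "AE x in lborel. norm x * f x = G1 x"
    using memLp_borel_representative[OF m1 p1] .
  obtain G2 where G2: "Lp_bdd p G2 (Lp_norm p (\<lambda>x. (norm x)\<^sup>2 * f x))"
    and ae2: "AE x in lborel. (norm x)\<^sup>2 * f x = G2 x"
    using memLp_borel_representative[OF m2 p1] .
  \<comment> \<open>Only first-layer directions \<open>b\<close> are expanded to second order; the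
    others stop at first order and feed \<open>F1\<close>.\<close>
  define F where "F b c = (if w b = 1 then dil_avg ?u1 (quad_part G2 b c) else (\<lambda>x. 0))" for b c
  \<comment> \<open>The minus sign cancels the one that skew-adjointness of \<open>X^b\<close> puts
    in front of \<open>F1\<close>.\<close>
  define F1 where "F1 b = dil_avg ?u0 (\<lambda>x. - lin_part G1 b x)" for b
  have C: "0 < C" using k0 by (simp add: kernel_def)
  have q: "Lp_bdd p (quad_part G2 b c) (Lp_norm p (\<lambda>x. (norm x)\<^sup>2 * f x))" if "b \<in> Basis" "c \<in> Basis" for b c
    using Lp_bdd_quad_part[OF G2 p1 that] .
  have l: "Lp_bdd p (\<lambda>x. - lin_part G1 b x) (Lp_norm p (\<lambda>x. norm x * f x))" if "b \<in> Basis" for b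
    using Lp_bdd_uminus[OF Lp_bdd_lin_part[OF G1 p1 that]] .
  have F: "memLp p (F b c) \<and> Lp_norm p (F b c) \<le> C * Lp_norm p (\<lambda>x. (norm x)\<^sup>2 * f x)"
    if "b \<in> Basis" "c \<in> Basis" for b c
    unfolding F_def
    using Lp_bdd_imp_memLp[OF Lp_bdd_dil_avg[OF q[OF that] k1 p1] p1]
      Lp_bdd_imp_memLp[OF Lp_bdd_zero p1, of "C * Lp_norm p (\<lambda>x. (norm x)\<^sup>2 * f x)"] C p1
    by (auto simp: Lp_norm_nonneg)
  have F1: "memLp p (F1 b) \<and> Lp_norm p (F1 b) \<le> C * Lp_norm p (\<lambda>x. norm x * f x)" if "b \<in> Basis" for b
    unfolding F1_def using Lp_bdd_imp_memLp[OF Lp_bdd_dil_avg[OF l[OF that] k0 p1] p1] .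
  have fm [measurable]: "f \<in> borel_measurable lebesgue"
    by (rule borel_measurable_lebesgue_off_0) (use m2 in \<open>simp add: memLp_def\<close>)
  have [measurable]: "(\<lambda>x::'a. norm x) \<in> borel_measurable lebesgue" "\<And>b::'a. (\<lambda>x::'a. x \<bullet> b) \<in> borel_measurable lebesgue"
    by (auto intro: measurable_completion)
  \<comment> \<open>The weighted integrability makes \<open>f\<close> and each \<open>x_b f\<close>
    integrable, so the four groups of Taylor terms can be integrated separately.\<close>
  have iw: "integrable lebesgue (\<lambda>x. \<bar>f x\<bar> * (1 + norm x))"
    using fin by (intro integrableI_nonneg) auto
  have if0: "integrable lebesgue f"
    by (rule Bochner_Integration.integrable_bound[OF iw]) (auto simp: algebra_simps)
  have if1: "integrable lebesgue (\<lambda>x. f x * (x \<bullet> b))" if "b \<in> Basis" for b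
  proof (rule Bochner_Integration.integrable_bound[OF iw])
    show "AE x in lebesgue. norm (f x * (x \<bullet> b)) \<le> norm (\<bar>f x\<bar> * (1 + norm x))"
    proof (rule AE_I2)
      fix x
      have "\<bar>x \<bullet> b\<bar> \<le> 1 + norm x" using Basis_le_norm[OF that, of x] by simp
      then show "norm (f x * (x \<bullet> b)) \<le> norm (\<bar>f x\<bar> * (1 + norm x))"
        by (auto simp: abs_mult intro!: mult_left_mono)
    qed
  qed auto
  have "distr_identity mul w f (\<integral>x. f x \<partial>lebesgue) (\<lambda>b. \<integral>x. f x * (x \<bullet> b) \<partial>lebesgue) F F1"
    unfolding distr_identity_def
  proof (intro allI impI)
    fix \<phi> :: "'a \<Rightarrow> real" assume "test_fn \<phi>"
    then obtain R where \<phi>: "smooth \<phi>" and R: "\<And>x. R < norm x \<Longrightarrow> \<phi> x = 0"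
      unfolding test_fn_def by blast
    have C1: "C1 \<phi>" "\<And>b. C1 (lvf mul b \<phi>)" using \<phi> by (auto intro: smooth_C1 C1_lvf)
    have s1: "lvf mul b \<phi> y = 0" if "R < norm y" for b y
      by (rule lvf_eq_0_outside[OF C1(1) R that])
    have s2: "lvf mul c (lvf mul b \<phi>) y = 0" if "R < norm y" for b c y
      by (rule lvf_eq_0_outside[OF C1(2) s1 that])
    define I1 where "I1 b x = (\<integral>t. ?u0 t * lvf mul b \<phi> (t *\<^sub>R x) \<partial>lborel)" for b x
    define I2 where "I2 b c x = (\<integral>t. ?u1 t * lvf mul c (lvf mul b \<phi>) (t *\<^sub>R x) \<partial>lborel)" for b c x
    note P1 = dil_avg_pairing_lebesgue[OF l k0 p1 C1_imp_continuous[OF C1(2)] s1, folded I1_def F1_def]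
    note P2 = dil_avg_pairing_lebesgue[OF q k1 p1 continuous_lvf[OF C1(2)] s2, folded I2_def]
    let ?B1 = "{b\<in>Basis. w b = 1}" and ?B2 = "{b\<in>Basis. w b \<noteq> 1}"
    have taylor: "\<phi> x = \<phi> 0 + (\<Sum>b\<in>?B1. (x \<bullet> b) * lvf mul b \<phi> 0)
        + (\<Sum>b\<in>?B1. \<Sum>c\<in>Basis. (x \<bullet> b) * (x \<bullet> c) * I2 b c x) + (\<Sum>b\<in>?B2. (x \<bullet> b) * I1 b x)" for x
    proof -
      \<comment> \<open>This second expansion is substituted only for \<open>w b = 1\<close>, which
        produces the \<open>X^b\<close> derivatives at the identity.\<close>
      have I1: "I1 b x = lvf mul b \<phi> 0 + (\<Sum>c\<in>Basis. (x \<bullet> c) * I2 b c x)" for b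
        unfolding I1_def I2_def using ray_Taylor_remainder[OF C1(2)] by simp
      have "\<phi> x = \<phi> 0 + (\<Sum>b\<in>Basis. (x \<bullet> b) * I1 b x)"
        unfolding I1_def by (rule ray_Taylor_1[OF C1(1)])
      also have "(\<Sum>b\<in>Basis. (x \<bullet> b) * I1 b x) = (\<Sum>b\<in>?B1. (x \<bullet> b) * I1 b x) + (\<Sum>b\<in>?B2. (x \<bullet> b) * I1 b x)"
        by (subst sum.union_disjoint[symmetric]) (auto intro!: sum.cong)
      also have "(\<Sum>b\<in>?B1. (x \<bullet> b) * I1 b x)
          = (\<Sum>b\<in>?B1. (x \<bullet> b) * lvf mul b \<phi> 0) + (\<Sum>b\<in>?B1. \<Sum>c\<in>Basis. (x \<bullet> b) * (x \<bullet> c) * I2 b c x)"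
        unfolding I1 by (simp add: distrib_left sum.distrib sum_distrib_left mult.assoc)
      finally show ?thesis by simp
    qed
    have ae\<phi>: "AE x in lebesgue. f x * \<phi> x = f x * \<phi> 0 + (\<Sum>b\<in>?B1. f x * (x \<bullet> b) * lvf mul b \<phi> 0)
        + (\<Sum>b\<in>?B1. \<Sum>c\<in>Basis. quad_part G2 b c x * I2 b c x) - (\<Sum>b\<in>?B2. - lin_part G1 b x * I1 b x)"
      using AE_completion[OF ae1] AE_completion[OF ae2] AE_completion[OF AE_lborel_singleton[of 0]]
    proof eventually_elim
      case (elim x)
      have e: "quad_part G2 b c x = f x * ((x \<bullet> b) * (x \<bullet> c))" "- lin_part G1 b x = - (f x * (x \<bullet> b))" for b c
        using elim(3) by (simp_all add: quad_part_def lin_part_def elim(1,2)[symmetric])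
      show ?case unfolding e taylor[of x]
        by (simp add: distrib_left sum_distrib_left sum_negf mult.assoc)
    qed
    have \<phi>m: "\<phi> \<in> borel_measurable lebesgue"
      by (intro measurable_completion) (simp add: borel_measurable_continuous_onI[OF C1_imp_continuous[OF C1(1)]])
    note i = if0 if1 P1(1) P2(1)
    have i': "integrable lebesgue (\<lambda>x. f x * \<phi> 0)"
        "integrable lebesgue (\<lambda>x. \<Sum>b\<in>?B1. f x * (x \<bullet> b) * lvf mul b \<phi> 0)"
        "integrable lebesgue (\<lambda>x. \<Sum>b\<in>?B1. \<Sum>c\<in>Basis. quad_part G2 b c x * I2 b c x)"
        "integrable lebesgue (\<lambda>x. \<Sum>b\<in>?B2. - lin_part G1 b x * I1 b x)"
      by (intro Bochner_Integration.integrable_sum integrable_mult_left i; simp)+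
    have "(\<integral>x. f x * \<phi> x \<partial>lebesgue)
       = (\<integral>x. f x * \<phi> 0 + (\<Sum>b\<in>?B1. f x * (x \<bullet> b) * lvf mul b \<phi> 0)
        + (\<Sum>b\<in>?B1. \<Sum>c\<in>Basis. quad_part G2 b c x * I2 b c x) - (\<Sum>b\<in>?B2. - lin_part G1 b x * I1 b x) \<partial>lebesgue)"
      by (rule integral_cong_AE[OF borel_measurable_times[OF fm \<phi>m] borel_measurable_integrable ae\<phi>])
        (intro Bochner_Integration.integrable_add Bochner_Integration.integrable_diff i')
    also have "\<dots> = (\<integral>x. f x * \<phi> 0 \<partial>lebesgue) + (\<integral>x. (\<Sum>b\<in>?B1. f x * (x \<bullet> b) * lvf mul b \<phi> 0) \<partial>lebesgue)
        + (\<integral>x. (\<Sum>b\<in>?B1. \<Sum>c\<in>Basis. quad_part G2 b c x * I2 b c x) \<partial>lebesgue)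
        - (\<integral>x. (\<Sum>b\<in>?B2. - lin_part G1 b x * I1 b x) \<partial>lebesgue)"
      by (simp only: Bochner_Integration.integral_diff Bochner_Integration.integral_add
          Bochner_Integration.integrable_add i')
    also have "(\<integral>x. (\<Sum>b\<in>?B1. f x * (x \<bullet> b) * lvf mul b \<phi> 0) \<partial>lebesgue)
        = (\<Sum>b\<in>?B1. (\<integral>x. f x * (x \<bullet> b) \<partial>lebesgue) * lvf mul b \<phi> 0)"
      by (subst Bochner_Integration.integral_sum) (auto intro!: integrable_mult_left if1)
    also have "(\<integral>x. (\<Sum>b\<in>?B1. \<Sum>c\<in>Basis. quad_part G2 b c x * I2 b c x) \<partial>lebesgue)
        = (\<Sum>b\<in>?B1. \<Sum>c\<in>Basis. \<integral>x. quad_part G2 b c x * I2 b c x \<partial>lebesgue)"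
      using P2(1) by (simp add: Bochner_Integration.integral_sum)
    also have "\<dots> = (\<Sum>b\<in>?B1. \<Sum>c\<in>Basis. \<integral>x. F b c x * lvf mul c (lvf mul b \<phi>) x \<partial>lebesgue)"
      by (intro sum.cong refl) (auto simp: F_def P2(2))
    also have "\<dots> = (\<Sum>b\<in>Basis. \<Sum>c\<in>Basis. \<integral>x. F b c x * lvf mul c (lvf mul b \<phi>) x \<partial>lebesgue)"
      by (rule sum.mono_neutral_left) (auto simp: F_def)
    also have "(\<integral>x. (\<Sum>b\<in>?B2. - lin_part G1 b x * I1 b x) \<partial>lebesgue)
        = (\<Sum>b\<in>?B2. \<integral>x. - lin_part G1 b x * I1 b x \<partial>lebesgue)"
      by (rule Bochner_Integration.integral_sum) (use P1(1) in simp)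
    also have "\<dots> = (\<Sum>b\<in>?B2. \<integral>x. F1 b x * lvf mul b \<phi> x \<partial>lebesgue)"
      by (intro sum.cong refl P1(2)[symmetric]) auto
    finally show "(\<integral>x. f x * \<phi> x \<partial>lebesgue) =
          (\<integral>x. f x \<partial>lebesgue) * \<phi> 0
        + (\<Sum>b\<in>?B1. (\<integral>x. f x * (x \<bullet> b) \<partial>lebesgue) * lvf mul b \<phi> 0)
        + (\<Sum>b\<in>Basis. \<Sum>c\<in>Basis. \<integral>x. F b c x * lvf mul c (lvf mul b \<phi>) x \<partial>lebesgue)
        - (\<Sum>b\<in>?B2. \<integral>x. F1 b x * lvf mul b \<phi> x \<partial>lebesgue)" by simp
  qed
  then show ?thesis
    by (intro exI[of _ F] exI[of _ F1] conjI ballI impI) (simp_all add: F F1)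
qed

text \<open>Expansion from infinity leaves neither boundary terms at the identity nor first-order
  terms, so the Dirac coefficients are 0 and \<open>F1 = 0\<close> is a valid choice.\<close>

lemma decomposition_supercritical:
  fixes mul :: "'a::euclidean_space \<Rightarrow> 'a \<Rightarrow> 'a" and f :: "'a \<Rightarrow> real"
  assumes "exp_coords mul" and p1: "1 \<le> p"
    and k: "kernel TYPE('a) p (\<lambda>t. indicator {1<..} t * (t - 1)) C"
    and m2: "memLp p (\<lambda>x. (norm x)\<^sup>2 * f x)"
  shows "\<exists>F F1.
            (\<forall>b\<in>Basis. \<forall>c\<in>Basis. memLp p (F b c) \<and>
                 Lp_norm p (F b c) \<le> C * Lp_norm p (\<lambda>x. (norm x)\<^sup>2 * f x)) \<and>
            (\<forall>b\<in>Basis. w b \<noteq> 1 \<longrightarrow> memLp p (F1 b) \<and>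
                 Lp_norm p (F1 b) \<le> C * Lp_norm p (\<lambda>x. norm x * f x)) \<and>
            distr_identity mul w f 0 (\<lambda>b. 0) F F1"
proof -
  interpret exp_coords mul by fact
  let ?u = "\<lambda>t::real. indicator {1<..} t * (t - 1) :: real"
  obtain G where G: "Lp_bdd p G (Lp_norm p (\<lambda>x. (norm x)\<^sup>2 * f x))"
    and ae: "AE x in lborel. (norm x)\<^sup>2 * f x = G x"
    using memLp_borel_representative[OF m2 p1] .
  define F where "F b c = dil_avg ?u (quad_part G b c)" for b c
  have C: "0 < C" using k by (simp add: kernel_def)
  have q: "Lp_bdd p (quad_part G b c) (Lp_norm p (\<lambda>x. (norm x)\<^sup>2 * f x))" if "b \<in> Basis" "c \<in> Basis" for b c
    using Lp_bdd_quad_part[OF G p1 that] .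
  have F: "memLp p (F b c) \<and> Lp_norm p (F b c) \<le> C * Lp_norm p (\<lambda>x. (norm x)\<^sup>2 * f x)"
    if "b \<in> Basis" "c \<in> Basis" for b c
    unfolding F_def using Lp_bdd_imp_memLp[OF Lp_bdd_dil_avg[OF q[OF that] k p1] p1] .
  have z: "memLp p (\<lambda>x::'a. 0) \<and> Lp_norm p (\<lambda>x::'a. 0) \<le> C * Lp_norm p (\<lambda>x. norm x * f x)"
    using C p1 by (intro Lp_bdd_imp_memLp Lp_bdd_zero) (auto simp: Lp_norm_nonneg)
  have fm: "f \<in> borel_measurable lebesgue"
    by (rule borel_measurable_lebesgue_off_0) (use m2 in \<open>simp add: memLp_def\<close>)
  have "distr_identity mul w f 0 (\<lambda>b. 0) F (\<lambda>b x. 0)"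
    unfolding distr_identity_def
  proof (intro allI impI)
    fix \<phi> :: "'a \<Rightarrow> real" assume "test_fn \<phi>"
    then obtain R where \<phi>: "smooth \<phi>" and R: "\<And>x. R < norm x \<Longrightarrow> \<phi> x = 0"
      unfolding test_fn_def by blast
    have C1: "C1 \<phi>" "\<And>b. C1 (lvf mul b \<phi>)" using \<phi> by (auto intro: smooth_C1 C1_lvf)
    have s1: "lvf mul b \<phi> y = 0" if "R < norm y" for b y
      by (rule lvf_eq_0_outside[OF C1(1) R that])
    have s2: "lvf mul c (lvf mul b \<phi>) y = 0" if "R < norm y" for b c y
      by (rule lvf_eq_0_outside[OF C1(2) s1 that])
    define I2 where "I2 b c x = (\<integral>t. ?u t * lvf mul c (lvf mul b \<phi>) (t *\<^sub>R x) \<partial>lborel)" for b c x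
    note P2 = dil_avg_pairing_lebesgue[OF q k p1 continuous_lvf[OF C1(2)] s2, folded I2_def F_def]
    have ae\<phi>: "AE x in lebesgue. f x * \<phi> x = (\<Sum>b\<in>Basis. \<Sum>c\<in>Basis. quad_part G b c x * I2 b c x)"
      \<comment> \<open>The origin is excluded because the ray through it never leaves the support;
        it is a null set.\<close>
      using AE_completion[OF ae] AE_completion[OF AE_lborel_singleton[of 0]]
    proof eventually_elim
      case (elim x)
      have e: "quad_part G b c x = f x * ((x \<bullet> b) * (x \<bullet> c))" for b c
        using elim(2) by (simp add: quad_part_def elim(1)[symmetric])
      have "\<phi> x = (\<Sum>b\<in>Basis. \<Sum>c\<in>Basis. (x \<bullet> b) * (x \<bullet> c) * I2 b c x)"
        unfolding I2_def by (rule ray_Taylor_infinity[OF \<phi> R elim(2)])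
      then show ?case unfolding e by (simp add: sum_distrib_left mult.assoc)
    qed
    have \<phi>m: "\<phi> \<in> borel_measurable lebesgue"
      by (intro measurable_completion) (simp add: borel_measurable_continuous_onI[OF C1_imp_continuous[OF C1(1)]])
    have i: "integrable lebesgue (\<lambda>x. \<Sum>b\<in>Basis. \<Sum>c\<in>Basis. quad_part G b c x * I2 b c x)"
      by (intro Bochner_Integration.integrable_sum P2(1))
    have "(\<integral>x. f x * \<phi> x \<partial>lebesgue)
       = (\<integral>x. (\<Sum>b\<in>Basis. \<Sum>c\<in>Basis. quad_part G b c x * I2 b c x) \<partial>lebesgue)"
      by (rule integral_cong_AE[OF borel_measurable_times[OF fm \<phi>m] borel_measurable_integrable[OF i] ae\<phi>])
    also have "\<dots> = (\<Sum>b\<in>Basis. \<Sum>c\<in>Basis. \<integral>x. F b c x * lvf mul c (lvf mul b \<phi>) x \<partial>lebesgue)"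
      using P2 by (simp add: Bochner_Integration.integral_sum)
    finally show "(\<integral>x. f x * \<phi> x \<partial>lebesgue) =
          0 * \<phi> 0
        + (\<Sum>b\<in>{b\<in>Basis. w b = 1}. 0 * lvf mul b \<phi> 0)
        + (\<Sum>b\<in>Basis. \<Sum>c\<in>Basis. \<integral>x. F b c x * lvf mul c (lvf mul b \<phi>) x \<partial>lebesgue)
        - (\<Sum>b\<in>{b\<in>Basis. w b \<noteq> 1}. \<integral>x. 0 * lvf mul b \<phi> x \<partial>lebesgue)" by simp
  qed
  then show ?thesis
    by (intro exI[of _ F] exI[of _ "\<lambda>b x. 0"] conjI ballI impI) (simp_all add: F z)
qed

section \<open>Assembling both ranges with constants independent of \<open>f\<close>\<close>

theorem mainTheorem2:
  fixes mul br :: "'a::euclidean_space \<Rightarrow> 'a \<Rightarrow> 'a"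
    and w :: "'a \<Rightarrow> nat" and s :: nat and p :: ereal
  assumes G: "carnot_group mul br w s"
    and p1: "1 \<le> p"
  shows
   "(p \<noteq> \<infinity> \<and> real_of_ereal p * (real (hom_dim w) - 1) < real (hom_dim w) \<longrightarrow>
      (\<exists>C::real. \<forall>f :: 'a \<Rightarrow> real.
         loc_integrable f \<and>
         (\<integral>\<^sup>+ x. ennreal (\<bar>f x\<bar> * (1 + norm x)) \<partial>lebesgue) < \<infinity> \<and>
         memLp p (\<lambda>x. norm x * f x) \<and> memLp p (\<lambda>x. (norm x)\<^sup>2 * f x)
         \<longrightarrow>
         (\<exists>F F1.
            (\<forall>b\<in>Basis. \<forall>c\<in>Basis. memLp p (F b c) \<and>
                 Lp_norm p (F b c) \<le> C * Lp_norm p (\<lambda>x. (norm x)\<^sup>2 * f x)) \<and>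
            (\<forall>b\<in>Basis. w b \<noteq> 1 \<longrightarrow> memLp p (F1 b) \<and>
                 Lp_norm p (F1 b) \<le> C * Lp_norm p (\<lambda>x. norm x * f x)) \<and>
            distr_identity mul w f
              (\<integral>x. f x \<partial>lebesgue) (\<lambda>b. \<integral>x. f x * (x \<bullet> b) \<partial>lebesgue) F F1)))
    \<and>
    (2 * s < hom_dim w \<and>
     (p = \<infinity> \<or> real_of_ereal p * (real (hom_dim w) - 2 * real s) > real (hom_dim w)) \<longrightarrow>
      (\<exists>C::real. \<forall>f :: 'a \<Rightarrow> real.
         loc_integrable f \<and>
         memLp p (\<lambda>x. norm x * f x) \<and> memLp p (\<lambda>x. (norm x)\<^sup>2 * f x)
         \<longrightarrow>
         (\<exists>F F1.
            (\<forall>b\<in>Basis. \<forall>c\<in>Basis. memLp p (F b c) \<and>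
                 Lp_norm p (F b c) \<le> C * Lp_norm p (\<lambda>x. (norm x)\<^sup>2 * f x)) \<and>
            (\<forall>b\<in>Basis. w b \<noteq> 1 \<longrightarrow> memLp p (F1 b) \<and>
                 Lp_norm p (F1 b) \<le> C * Lp_norm p (\<lambda>x. norm x * f x)) \<and>
            distr_identity mul w f 0 (\<lambda>b. 0) F F1)))"
proof (intro conjI impI)
  note grp = carnot_group_exp_coords[OF G]
  {
    assume h: "p \<noteq> \<infinity> \<and> real_of_ereal p * (real (hom_dim w) - 1) < real (hom_dim w)"
    have "real DIM('a) - 1 < dil_exp TYPE('a) p"
      using dil_exp_subcritical[OF G p1] h by blast
    \<comment> \<open>The kernel constant is fixed before \<open>f\<close> is introduced, which
      gives the required uniformity of the estimates.\<close>
    then obtain C where k: "kernel TYPE('a) p (indicator {0<..<1}) C"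
      "kernel TYPE('a) p (\<lambda>t. indicator {0<..<1} t * (1 - t)) C"
      by (rule kernel_unit)
    show "\<exists>C::real. \<forall>f :: 'a \<Rightarrow> real.
         loc_integrable f \<and>
         (\<integral>\<^sup>+ x. ennreal (\<bar>f x\<bar> * (1 + norm x)) \<partial>lebesgue) < \<infinity> \<and>
         memLp p (\<lambda>x. norm x * f x) \<and> memLp p (\<lambda>x. (norm x)\<^sup>2 * f x)
         \<longrightarrow>
         (\<exists>F F1.
            (\<forall>b\<in>Basis. \<forall>c\<in>Basis. memLp p (F b c) \<and>
                 Lp_norm p (F b c) \<le> C * Lp_norm p (\<lambda>x. (norm x)\<^sup>2 * f x)) \<and>
            (\<forall>b\<in>Basis. w b \<noteq> 1 \<longrightarrow> memLp p (F1 b) \<and>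
                 Lp_norm p (F1 b) \<le> C * Lp_norm p (\<lambda>x. norm x * f x)) \<and>
            distr_identity mul w f
              (\<integral>x. f x \<partial>lebesgue) (\<lambda>b. \<integral>x. f x * (x \<bullet> b) \<partial>lebesgue) F F1)"
      by (intro exI[of _ C] allI impI, elim conjE) (rule decomposition_subcritical[OF grp p1 k])
  next
    assume h: "2 * s < hom_dim w \<and>
      (p = \<infinity> \<or> real_of_ereal p * (real (hom_dim w) - 2 * real s) > real (hom_dim w))"
    have "dil_exp TYPE('a) p < real DIM('a) - 2"
      using dil_exp_supercritical[OF G p1] h by blast
    then obtain C where k: "kernel TYPE('a) p (\<lambda>t. indicator {1<..} t * (t - 1)) C"
      by (rule kernel_tail)
    show "\<exists>C::real. \<forall>f :: 'a \<Rightarrow> real.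
         loc_integrable f \<and>
         memLp p (\<lambda>x. norm x * f x) \<and> memLp p (\<lambda>x. (norm x)\<^sup>2 * f x)
         \<longrightarrow>
         (\<exists>F F1.
            (\<forall>b\<in>Basis. \<forall>c\<in>Basis. memLp p (F b c) \<and>
                 Lp_norm p (F b c) \<le> C * Lp_norm p (\<lambda>x. (norm x)\<^sup>2 * f x)) \<and>
            (\<forall>b\<in>Basis. w b \<noteq> 1 \<longrightarrow> memLp p (F1 b) \<and>
                 Lp_norm p (F1 b) \<le> C * Lp_norm p (\<lambda>x. norm x * f x)) \<and>
            distr_identity mul w f 0 (\<lambda>b. 0) F F1)"
      by (intro exI[of _ C] allI impI, elim conjE) (rule decomposition_supercritical[OF grp p1 k])
  }
qed

end
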